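(* Let $\Omega\subset\mathbb{R}^n$ be nonempty, open and bounded. Let $\rho:\mathbb{R}^n\to[0,\infty]$ have compact support, be differentiable outside the origin, and satisfy, for some $\varepsilon>0$: (a) $\rho$ is radial with radial representation $\overline\rho$, $\rho(x)<\infty$ for all $x\ne0$, $\rho\in L^1_{\mathrm{loc}}(\mathbb{R}^n)$, $\int_{\mathbb{R}^n}\min\{1,|x|^{-1}\}\rho(x)\,dx<\infty$, and $\inf_{B_\varepsilon}\rho>0$; (b) the function $f_\rho:(0,\infty)\to\mathbb{R}$, $f_\rho(t)=t^{n-2}\overline\rho(t)$, is decreasing, and there is $0<\mu<1$ such that $\mu f_\rho(t/2)\ge f_\rho(t)$ for all $t\in(0,\varepsilon)$; (c) for some $\gamma\in(0,1)$ the function $t\mapsto t^{n+\gamma-1}\overline\rho(t)$ is almost increasing on $(0,\varepsilon)$. Then the following two statements hold. (i) If there is a constant $C=C(\Omega,n,\rho)>0$ such that $\|u\|_{L^2(\Omega)}\le C\|D_\rho u\|_{L^2(\mathbb{R}^n,\mathbb{R}^n)}$ for all $u\in H^\rho_0(\Omega)$, then $\limsup_{t\downarrow0}t^{n-1}\overline\rho(t)>0$. (ii) If $H^\rho_0(\Omega)$ is compactly embedded into $L^2(\mathbb{R}^n)$, then $\limsup_{t\downarrow0}t^{n-1}\overline\rho(t)=\infty$.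
   Context: Here $n\in\mathbb{N}$, $n\ge1$; $B_r$ is the open ball of radius $r$ centred at $0$; radial means $\rho(x)=\overline{\rho}(|x|)$ with $\overline\rho$ defined on $[0,\infty)$ (the radial representation); "decreasing" is non-strict. A function $f$ is almost increasing on an interval $I$ if there is $C>0$ with $f(t_1)\le Cf(t_2)$ for all $t_1\le t_2$ in $I$. For $\Phi\in C_c^\infty(\mathbb{R}^n,\mathbb{R}^n)$, $\operatorname{div}_\rho\Phi(x)=\int_{\mathbb{R}^n}\frac{\Phi(x)-\Phi(y)}{|x-y|}\cdot\frac{x-y}{|x-y|}\rho(x-y)\,dy$. For $u\in L^1(\mathbb{R}^n)+L^\infty(\mathbb{R}^n)$ the weak nonlocal gradient $D_\rho u$ is the distribution $\langle D_\rho u,\Phi\rangle=-\int_{\mathbb{R}^n}u\,\operatorname{div}_\rho\Phi\,dx$. $H^\rho(\mathbb{R}^n)$ is the set of (real-valued) $u\in L^2(\mathbb{R}^n)$ with $D_\rho u\in L^2(\mathbb{R}^n,\mathbb{R}^n)$, with norm $\left(\|u\|_{L^2}^2+\|D_\rho u\|_{L^2}^2\right)^{1/2}$, and $H^\rho_0(\Omega)=\{u\in H^\rho(\mathbb{R}^n):u=0\text{ a.e. in }\Omega^c\}$ with the same norm. *)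

theory Defs
  imports "HOL-Analysis.Analysis"
begin

text \<open>
  Functions are represented pointwise, not as classes modulo null sets; the norms, weak
  gradients and function spaces below are invariant under changes on a null set.
\<close>

definition L2 :: "('a::euclidean_space \<Rightarrow> 'b::euclidean_space) set" where
  "L2 = {u \<in> borel_measurable lebesgue. integrable lebesgue (\<lambda>x. (norm (u x))\<^sup>2)}"

definition L2_norm_on :: "'a::euclidean_space set \<Rightarrow> ('a \<Rightarrow> 'b::euclidean_space) \<Rightarrow> real" where
  "L2_norm_on A u = sqrt (LINT x:A|lebesgue. (norm (u x))\<^sup>2)"

definition L1_loc :: "('a::euclidean_space \<Rightarrow> ennreal) \<Rightarrow> bool" where
  "L1_loc \<rho> \<longleftrightarrow> \<rho> \<in> borel_measurable lebesgue \<and>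
     (\<forall>K. compact K \<longrightarrow> (\<integral>\<^sup>+x\<in>K. \<rho> x \<partial>lebesgue) < \<infinity>)"

definition support :: "('a::topological_space \<Rightarrow> 'b::zero) \<Rightarrow> 'a set" where
  "support f = closure {x. f x \<noteq> 0}"

primrec Ck :: "nat \<Rightarrow> ('a::euclidean_space \<Rightarrow> 'b::euclidean_space) \<Rightarrow> bool" where
  "Ck 0 f \<longleftrightarrow> continuous_on UNIV f"
| "Ck (Suc k) f \<longleftrightarrow> (\<forall>x. f differentiable (at x)) \<and>
     (\<forall>v. Ck k (\<lambda>x. frechet_derivative f (at x) v))"

definition test_functions :: "('a::euclidean_space \<Rightarrow> 'b::euclidean_space) set" where
  "test_functions = {\<Phi>. (\<forall>k. Ck k \<Phi>) \<and> compact (support \<Phi>)}"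

text \<open>
  The kernel \<open>\<rho>\<close> may be infinite at the origin only, so \<open>enn2real\<close> alters the integrand below
  at most at \<open>y = x\<close>, where it is \<open>0\<close> by the convention for division by zero.
\<close>

definition nonlocal_div ::
  "('a::euclidean_space \<Rightarrow> ennreal) \<Rightarrow> ('a \<Rightarrow> 'a) \<Rightarrow> 'a \<Rightarrow> real" where
  "nonlocal_div \<rho> \<Phi> x =
     (LINT y|lebesgue. (((\<Phi> x - \<Phi> y) /\<^sub>R norm (x - y)) \<bullet> ((x - y) /\<^sub>R norm (x - y)))
                          * enn2real (\<rho> (x - y)))"

definition weak_grad ::
  "('a::euclidean_space \<Rightarrow> ennreal) \<Rightarrow> ('a \<Rightarrow> real) \<Rightarrow> ('a \<Rightarrow> 'a) \<Rightarrow> real" where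
  "weak_grad \<rho> u \<Phi> = - (LINT x|lebesgue. u x * nonlocal_div \<rho> \<Phi> x)"

definition L2_representatives ::
  "(('a::euclidean_space \<Rightarrow> 'a) \<Rightarrow> real) \<Rightarrow> ('a \<Rightarrow> 'a) set" where
  "L2_representatives T =
     {G \<in> L2. \<forall>\<Phi>\<in>test_functions. T \<Phi> = (LINT x|lebesgue. G x \<bullet> \<Phi> x)}"

text \<open>
  The \<open>L\<^sup>2\<close> norm of a distribution that belongs to \<open>L\<^sup>2\<close>. Its representatives agree almost
  everywhere, so the infimum is taken over a one-element set: the norm of any representative.
\<close>

definition dist_L2_norm :: "(('a::euclidean_space \<Rightarrow> 'a) \<Rightarrow> real) \<Rightarrow> real" where
  "dist_L2_norm T = (INF G\<in>L2_representatives T. L2_norm_on UNIV G)"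

definition Hrho :: "('a::euclidean_space \<Rightarrow> ennreal) \<Rightarrow> ('a \<Rightarrow> real) set" where
  "Hrho \<rho> = {u \<in> L2. L2_representatives (weak_grad \<rho> u) \<noteq> {}}"

definition Hrho_norm :: "('a::euclidean_space \<Rightarrow> ennreal) \<Rightarrow> ('a \<Rightarrow> real) \<Rightarrow> real" where
  "Hrho_norm \<rho> u = sqrt ((L2_norm_on UNIV u)\<^sup>2 + (dist_L2_norm (weak_grad \<rho> u))\<^sup>2)"

definition Hrho0 :: "('a::euclidean_space \<Rightarrow> ennreal) \<Rightarrow> 'a set \<Rightarrow> ('a \<Rightarrow> real) set" where
  "Hrho0 \<rho> \<Omega> = {u \<in> Hrho \<rho>. AE x in lebesgue. x \<notin> \<Omega> \<longrightarrow> u x = 0}"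

text \<open>
  Compactness of the inclusion of a space \<open>X\<close> with norm \<open>N\<close> into \<open>L\<^sup>2\<close>: bounded sequences have
  subsequences that converge in \<open>L\<^sup>2\<close>.
\<close>

definition compactly_embedded_L2 ::
  "('a::euclidean_space \<Rightarrow> real) set \<Rightarrow> (('a \<Rightarrow> real) \<Rightarrow> real) \<Rightarrow> bool" where
  "compactly_embedded_L2 X N \<longleftrightarrow> X \<subseteq> L2 \<and>
     (\<forall>u :: nat \<Rightarrow> 'a \<Rightarrow> real. range u \<subseteq> X \<and> bounded (range (\<lambda>k. N (u k))) \<longrightarrow>
        (\<exists>r v. strict_mono r \<and> v \<in> L2 \<and>
           (\<lambda>k. L2_norm_on UNIV (\<lambda>x. u (r k) x - v x)) \<longlonglongrightarrow> 0))"

definition almost_increasing_on :: "real set \<Rightarrow> (real \<Rightarrow> real) \<Rightarrow> bool" where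
  "almost_increasing_on I f \<longleftrightarrow>
     (\<exists>C>0. \<forall>t1\<in>I. \<forall>t2\<in>I. t1 \<le> t2 \<longrightarrow> f t1 \<le> C * f t2)"

end

theory Submission
  imports Defs
begin

text \<open>
  Write \<open>R\<close> for the real-valued kernel, \<open>K z = R z *\<^sub>R z / |z|\<^sup>2\<close> and \<open>n\<close> for the dimension. For a Lipschitz
  function \<open>u\<close> with compact support, the distribution \<open>D\<^sub>\<rho> u\<close> is the function
  \<open>x \<mapsto> \<integral> (u x - u (x - z)) K z dz\<close>, because \<open>K\<close> is odd and \<open>|z| |K z| = R z\<close> is integrable
  (\<open>weak_grad_eq\<close>). When the upper limit is too small, the premises of both claims are refuted by the same
  sequence of wave packets \<open>u\<^sub>k x = \<phi> x * cos (k (x \<bullet> e))\<close>, where \<open>\<phi>\<close> is a Lipschitz bump inside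
  \<open>\<Omega>\<close> and \<open>e\<close> a unit vector.

  Replacing \<open>\<phi> (x - z)\<close> by \<open>\<phi> x\<close> splits the gradient of \<open>u\<^sub>k\<close> into two parts
  (\<open>nonlocal_grad_wave_packet\<close>):
  \<^item> a pure oscillation \<open>- \<phi> x * sin (k (x \<bullet> e)) *\<^sub>R m (k e)\<close> with the vector
    \<open>m \<xi> = \<integral> sin (z \<bullet> \<xi>) K z dz\<close>, which is the Fourier symbol of \<open>D\<^sub>\<rho>\<close> up to the factor \<open>\<i>\<close>;
  \<^item> a remainder with an integrable, oscillating integrand. It is bounded with a support that does
    not depend on \<open>k\<close>, and it tends to \<open>0\<close> pointwise by the Riemann-Lebesgue lemma, hence in \<open>L\<^sup>2\<close>.

  Thus the size of \<open>D\<^sub>\<rho> u\<^sub>k\<close> is governed by \<open>m (k e)\<close>. Along the ray through \<open>w\<close>, the integral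
  defining \<open>m\<close> becomes the sine transform of the decreasing function \<open>t \<mapsto> f\<^sub>\<rho> (t |w|)\<close>. The sine
  transform of a decreasing function \<open>h\<close> with \<open>t * h t \<le> M\<close> is at most \<open>3 M\<close> for every frequency
  (\<open>abs_sine_transform_le\<close>, by the second mean value theorem), so cancellation makes up for the
  failure of \<open>K\<close> to be integrable. As \<open>t * f\<^sub>\<rho> t\<close> is \<open>t\<close> to the power \<open>n - 1\<close> times the radial profile of \<open>\<rho>\<close>,
  the following holds: if the upper limit is finite, then \<open>m (k e)\<close> is bounded in \<open>k\<close>; if it is
  \<open>0\<close>, then \<open>m (k e)\<close> tends to \<open>0\<close> (\<open>norm_symbol_le\<close>).

  Finally \<open>\<parallel>u\<^sub>k\<parallel>\<^sup>2\<close> tends to \<open>\<parallel>\<phi>\<parallel>\<^sup>2 / 2 > 0\<close>. So an upper limit \<open>0\<close> gives gradients tending to \<open>0\<close> and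
  contradicts the Poincare inequality; a finite upper limit gives a bounded sequence in \<open>H\<^sup>\<rho>\<^sub>0\<close>,
  and no subsequence of it is a Cauchy sequence in \<open>L\<^sup>2\<close>, since \<open>\<parallel>u\<^sub>k - u\<^sub>j\<parallel>\<^sup>2\<close> tends to
  \<open>\<parallel>\<phi>\<parallel>\<^sup>2 / 2 + \<parallel>u\<^sub>j\<parallel>\<^sup>2\<close> as \<open>k\<close> grows.
\<close>

section \<open>Affine substitutions and integration along rays\<close>

lemma integrable_lborel_affine:
  fixes f :: "'a::euclidean_space \<Rightarrow> 'b::{banach, second_countable_topology}"
  assumes "integrable lborel f" "c \<noteq> 0"
  shows "integrable lborel (\<lambda>x. f (a + c *\<^sub>R x))"
proof -
  have [measurable]: "f \<in> borel_measurable borel"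
    using assms(1) by auto
  have "integrable (density (distr lborel borel (\<lambda>x. a + c *\<^sub>R x)) (\<lambda>_. ennreal (\<bar>c\<bar>^DIM('a)))) f"
    using assms lborel_affine[of c a] by simp
  then have "integrable lborel (\<lambda>x. (\<bar>c\<bar>^DIM('a)) *\<^sub>R f (a + c *\<^sub>R x))"
    by (subst (asm) integrable_density) (auto simp: integrable_distr_eq)
  then show ?thesis
    using assms(2) integrable_scaleR_right[of "inverse (\<bar>c\<bar>^DIM('a))" lborel "\<lambda>x. (\<bar>c\<bar>^DIM('a)) *\<^sub>R f (a + c *\<^sub>R x)"]
    by simp
qed

lemma integral_lborel_affine:
  fixes f :: "'a::euclidean_space \<Rightarrow> 'b::{banach, second_countable_topology}"
  assumes [measurable]: "f \<in> borel_measurable borel" and c: "c \<noteq> 0"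
  shows "(LINT x|lborel. f x) = \<bar>c\<bar>^DIM('a) *\<^sub>R (LINT x|lborel. f (a + c *\<^sub>R x))"
proof -
  have "(LINT x|lborel. f x) = (LINT x|density (distr lborel borel (\<lambda>x. a + c *\<^sub>R x)) (\<lambda>_. ennreal (\<bar>c\<bar>^DIM('a))). f x)"
    using lborel_affine[of c a] c by simp
  also have "\<dots> = (LINT x|lborel. \<bar>c\<bar>^DIM('a) *\<^sub>R f (a + c *\<^sub>R x))"
    by (subst integral_density) (auto simp: integral_distr)
  finally show ?thesis
    using c by simp
qed

lemma integral_lborel_reflect:
  fixes f :: "'a::euclidean_space \<Rightarrow> 'b::{banach, second_countable_topology}"
  assumes [measurable]: "f \<in> borel_measurable borel"
  shows "(LINT x|lborel. f (a - x)) = (LINT x|lborel. f x)"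
  using integral_lborel_affine[of f "-1" a] by simp

lemma integral_lborel_shift:
  fixes f :: "'a::euclidean_space \<Rightarrow> 'b::{banach, second_countable_topology}"
  assumes [measurable]: "f \<in> borel_measurable borel"
  shows "(LINT x|lborel. f (x + a)) = (LINT x|lborel. f x)"
  using integral_lborel_affine[of f 1 a] by (simp add: add.commute)

lemma integrable_lborel_shift:
  fixes f :: "'a::euclidean_space \<Rightarrow> 'b::{banach, second_countable_topology}"
  assumes "integrable lborel f"
  shows "integrable lborel (\<lambda>x. f (x + a))"
  using integrable_lborel_affine[OF assms, of 1 a] by (simp add: add.commute)

text \<open>
  The weight that makes integration along rays work: the interval from \<open>r / 2\<close> to \<open>r\<close> has
  measure \<open>ln 2\<close> with respect to \<open>dt / t\<close>, whatever \<open>r\<close> is.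
\<close>

lemma has_integral_inverse_dyadic:
  fixes r :: real
  assumes r: "r > 0"
  shows "has_bochner_integral lborel (\<lambda>t. indicator {r / 2..r} t *\<^sub>R inverse t) (ln 2)"
proof -
  have "has_bochner_integral lborel (\<lambda>t. indicator {r / 2..r} t *\<^sub>R inverse t) (ln r - ln (r / 2))"
  proof (rule has_bochner_integral_FTC_Icc)
    show "r / 2 \<le> r" using r by simp
    show "(ln has_vector_derivative inverse t) (at t within {r / 2..r})" if "r / 2 \<le> t" "t \<le> r" for t
      using r that by (auto intro!: derivative_eq_intros simp: has_real_derivative_iff_has_vector_derivative[symmetric] divide_simps)
    show "continuous_on {r / 2..r} inverse"
      using r by (intro continuous_on_inverse continuous_on_id) auto
  qed
  then show ?thesis
    using r by (simp add: ln_div)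
qed

text \<open>
  A form of polar coordinates that needs no measure on the sphere. Multiply \<open>F z\<close> by
  \<open>ln 2 = \<integral> dt / t\<close> over \<open>|z| / 2 \<le> t \<le> |z|\<close>, exchange the integrals, and substitute \<open>z = t w\<close>, which
  turns the constraint on \<open>t\<close> into one on \<open>w\<close> alone. In place of the unit sphere the directions
  range over a spherical shell.
\<close>

lemma integral_rays:
  fixes F :: "'a::euclidean_space \<Rightarrow> 'b::{banach, second_countable_topology}"
  defines "A \<equiv> {w::'a. 1 \<le> norm w \<and> norm w \<le> 2}"
  assumes F: "integrable lborel F"
  shows "ln 2 *\<^sub>R (LINT z|lborel. F z) =
    (LINT w|lborel. LINT t|lborel. (indicator A w * indicator {0<..} t * t ^ (DIM('a) - 1)) *\<^sub>R F (t *\<^sub>R w))"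
    (is "_ = (LINT w|lborel. LINT t|lborel. ?G w t)")
    and "integrable lborel (\<lambda>w. LINT t|lborel. (indicator A w * indicator {0<..} t * t ^ (DIM('a) - 1)) *\<^sub>R F (t *\<^sub>R w))"
proof -

  have [measurable]: "F \<in> borel_measurable borel"
    using F by auto
  have [measurable]: "A \<in> sets borel"
    unfolding A_def by measurable
  \<comment> \<open>\<open>H z t\<close> is the integrand before the substitution \<open>z = t w\<close>.\<close>
  define H where "H z t = (indicator {norm z / 2..norm z} t * inverse t) *\<^sub>R F z" for z t
  have [measurable]: "(\<lambda>(z, t). H z t) \<in> borel_measurable (lborel \<Otimes>\<^sub>M lborel)"
    unfolding H_def indicator_def atLeastAtMost_iff by measurable
  have [measurable]: "(\<lambda>(w, t). ?G w t) \<in> borel_measurable (lborel \<Otimes>\<^sub>M lborel)"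
    by measurable
  have "AE z in lborel. z \<noteq> (0::'a)"
    by (rule AE_lborel_singleton)
  then have H_t: "AE z in lborel. has_bochner_integral lborel (H z) (ln 2 *\<^sub>R F z)
      \<and> has_bochner_integral lborel (\<lambda>t. norm (H z t)) (ln 2 * norm (F z))"
  proof eventually_elim
    case (elim z)
    then have "has_bochner_integral lborel (\<lambda>t. indicator {norm z / 2..norm z} t *\<^sub>R inverse t) (ln 2)"
      by (intro has_integral_inverse_dyadic) simp
    moreover have "norm (H z t) = (indicator {norm z / 2..norm z} t * inverse t) * norm (F z)" for t
      using elim by (auto simp: H_def indicator_def not_less intro: order_trans[of 0 "norm z / 2"])
    ultimately show ?case
      by (auto simp: H_def[abs_def] intro!: has_bochner_integral_scaleR_left has_bochner_integral_mult_left)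
  qed
  have int_H: "integrable (lborel \<Otimes>\<^sub>M lborel) (\<lambda>(z, t). H z t)"
  proof (rule lborel_pair.Fubini_integrable)
    have "integrable lborel (\<lambda>z. ln 2 * norm (F z))"
      using F by simp
    moreover have "(\<lambda>z. LINT t|lborel. norm (H z t)) \<in> borel_measurable lborel"
      by measurable
    moreover have "AE z in lborel. (LINT t|lborel. norm (H z t)) = ln 2 * norm (F z)"
      using H_t by eventually_elim (auto dest: has_bochner_integral_integral_eq)
    ultimately show "integrable lborel (\<lambda>z. LINT t|lborel. norm (case (z, t) of (z, t) \<Rightarrow> H z t))"
      unfolding prod.case by (subst integrable_cong_AE[where g = "\<lambda>z. ln 2 * norm (F z)"]) measurable
    show "AE z in lborel. integrable lborel (\<lambda>t. case (z, t) of (z, t) \<Rightarrow> H z t)"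
      using H_t by eventually_elim (auto dest: integrable.intros)
  qed measurable
  have scaled: "t ^ DIM('a) *\<^sub>R H (t *\<^sub>R w) t = ?G w t" if "t > 0" for t w
  proof -
    have "t ^ DIM('a) = t ^ (DIM('a) - 1) * t"
      using DIM_positive[where 'a='a] by (metis power_minus_mult)
    then show ?thesis
      using that by (auto simp: H_def A_def indicator_def field_simps)
  qed
  have zero: "H z t = 0" "?G w t = 0" if "t \<le> 0" for z t w
    using that by (auto simp: H_def indicator_def not_le)
  have G_eq: "(LINT w|lborel. ?G w t) = (LINT z|lborel. H z t)" for t
  proof (cases "t > 0")
    case True
    have "(LINT z|lborel. H z t) = t ^ DIM('a) *\<^sub>R (LINT w|lborel. H (t *\<^sub>R w) t)"
      using True by (subst integral_lborel_affine[of "\<lambda>z. H z t" t 0]) auto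
    also have "\<dots> = (LINT w|lborel. ?G w t)"
      using scaled[OF True] True by (subst integral_scaleR_right[symmetric]) auto
    finally show ?thesis by simp
  qed (use zero in \<open>simp add: not_less\<close>)
  have G_norm: "(LINT w|lborel. norm (?G w t)) = (LINT z|lborel. norm (H z t))" for t
  proof (cases "t > 0")
    case True
    have "(LINT z|lborel. norm (H z t)) = t ^ DIM('a) *\<^sub>R (LINT w|lborel. norm (H (t *\<^sub>R w) t))"
      using True by (subst integral_lborel_affine[of "\<lambda>z. norm (H z t)" t 0]) auto
    also have "\<dots> = (LINT w|lborel. norm (t ^ DIM('a) *\<^sub>R H (t *\<^sub>R w) t))"
      using True by simp
    also have "\<dots> = (LINT w|lborel. norm (?G w t))"
      unfolding scaled[OF True] ..
    finally show ?thesis by simp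
  qed (use zero in \<open>simp add: not_less\<close>)
  have int_G: "integrable (lborel \<Otimes>\<^sub>M lborel) (\<lambda>(t, w). ?G w t)"
  proof (rule lborel_pair.Fubini_integrable)
    show "integrable lborel (\<lambda>t. LINT w|lborel. norm (case (t, w) of (t, w) \<Rightarrow> ?G w t))"
      unfolding prod.case G_norm using lborel_pair.integrable_snd[of "\<lambda>z t. norm (H z t)"] int_H
      by (simp add: case_prod_beta')
    have "AE t in lborel. integrable lborel (\<lambda>z. H z t)"
      using lborel_pair.AE_integrable_snd int_H by blast
    then show "AE t in lborel. integrable lborel (\<lambda>w. case (t, w) of (t, w) \<Rightarrow> ?G w t)"
    proof eventually_elim
      case (elim t)
      show ?case
      proof (cases "t > 0")
        case True
        then show ?thesis
          using integrable_scaleR_right[OF integrable_lborel_affine[OF elim, of t 0], of "t ^ DIM('a)"] True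
          by (simp only: scaled prod.case add_0_left)
      qed (use zero in \<open>simp add: not_less\<close>)
    qed
  qed measurable
  have int_G': "integrable (lborel \<Otimes>\<^sub>M lborel) (\<lambda>(w, t). ?G w t)"
    using lborel_pair.integrable_product_swap[OF int_G] by (simp add: case_prod_beta')
  show "integrable lborel (\<lambda>w. LINT t|lborel. ?G w t)"
    using lborel_pair.integrable_fst[OF int_G'] .
  have "ln 2 *\<^sub>R (LINT z|lborel. F z) = (LINT z|lborel. LINT t|lborel. H z t)"
    unfolding integral_scaleR_right[symmetric]
  proof (rule integral_cong_AE)
    show "AE z in lborel. ln 2 *\<^sub>R F z = (LINT t|lborel. H z t)"
      using H_t by eventually_elim (auto dest: has_bochner_integral_integral_eq)
  qed measurable
  also have "\<dots> = (LINT t|lborel. LINT z|lborel. H z t)"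
    by (rule lborel_pair.Fubini_integral[symmetric, OF int_H])
  also have "\<dots> = (LINT t|lborel. LINT w|lborel. ?G w t)"
    unfolding G_eq ..
  also have "\<dots> = (LINT w|lborel. LINT t|lborel. ?G w t)"
    by (rule lborel_pair.Fubini_integral[OF int_G'])
  finally show "ln 2 *\<^sub>R (LINT z|lborel. F z) = (LINT w|lborel. LINT t|lborel. ?G w t)" .
qed

lemma integrable_pair_dominated:
  fixes P :: "'a::euclidean_space \<Rightarrow> 'b::euclidean_space \<Rightarrow> 'c::{banach, second_countable_topology}"
  assumes f: "integrable lborel f" and g: "integrable lborel g"
    and meas: "(\<lambda>(x, y). P x y) \<in> borel_measurable (lborel \<Otimes>\<^sub>M lborel)"
    and le: "\<And>x y. norm (P x y) \<le> f x * g y"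
  shows "integrable (lborel \<Otimes>\<^sub>M lborel) (\<lambda>(x, y). P x y)"
proof -
  have [measurable]: "f \<in> borel_measurable borel" "g \<in> borel_measurable borel"
    using f g by auto
  have "integrable (lborel \<Otimes>\<^sub>M lborel) (\<lambda>(x, y). f x * g y)"
  proof (rule lborel_pair.Fubini_integrable)
    have "(\<lambda>x. LINT y|lborel. norm (f x * g y)) = (\<lambda>x. \<bar>f x\<bar> * (LINT y|lborel. \<bar>g y\<bar>))"
      by (simp add: abs_mult)
    then show "integrable lborel (\<lambda>x. LINT y|lborel. norm (case (x, y) of (x, y) \<Rightarrow> f x * g y))"
      using f by simp
  qed (use g in auto)
  then show ?thesis
    using meas
  proof (rule Bochner_Integration.integrable_bound)
    show "AE p in lborel \<Otimes>\<^sub>M lborel. norm (case p of (x, y) \<Rightarrow> P x y) \<le> norm (case p of (x, y) \<Rightarrow> f x * g y)"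
      using le by (intro AE_I2) (auto intro: order_trans[OF _ abs_ge_self])
  qed
qed

lemma continuous_compact_support_integrable:
  fixes g :: "'a::euclidean_space \<Rightarrow> 'b::{banach, second_countable_topology}"
  assumes "continuous_on UNIV g" "\<And>x. r < norm x \<Longrightarrow> g x = 0"
  shows "integrable lborel g"
proof -
  have "integrable lborel (\<lambda>x. indicator (cball 0 r) x *\<^sub>R g x)"
    using assms(1) by (intro borel_integrable_compact) (auto intro: continuous_on_subset)
  moreover have "(\<lambda>x. indicator (cball 0 r) x *\<^sub>R g x) = g"
    using assms(2) by (auto simp: indicator_def)
  ultimately show ?thesis
    by simp
qed

section \<open>Oscillatory integrals\<close>

lemma abs_cos_diff_le: "\<bar>cos a - cos b\<bar> \<le> \<bar>a - b\<bar>" for a b :: real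
proof -
  have "\<bar>cos a - cos b\<bar> = 2 * \<bar>sin ((a + b) / 2)\<bar> * \<bar>sin ((b - a) / 2)\<bar>"
    by (simp add: cos_diff_cos abs_mult)
  also have "\<dots> \<le> 2 * 1 * \<bar>(b - a) / 2\<bar>"
    by (intro mult_mono abs_sin_x_le_abs_x) auto
  finally show ?thesis by simp
qed

lemma integral_sin_le_two_over:
  fixes s :: real
  assumes "s > 0" "c \<le> d"
  shows "((\<lambda>t. sin (s * t)) has_integral (cos (s * c) - cos (s * d)) / s) {c..d}"
    and "\<bar>integral {c..d} (\<lambda>t. sin (s * t))\<bar> \<le> 2 / s"
proof -
  have "((\<lambda>t. sin (s * t)) has_integral (- cos (s * d) / s - (- cos (s * c) / s))) {c..d}"
    using assms by (intro fundamental_theorem_of_calculus)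
      (auto intro!: derivative_eq_intros simp: has_real_derivative_iff_has_vector_derivative[symmetric])
  then show *: "((\<lambda>t. sin (s * t)) has_integral (cos (s * c) - cos (s * d)) / s) {c..d}"
    by (simp add: diff_divide_distrib)
  have "\<bar>cos (s * c) - cos (s * d)\<bar> \<le> 2"
    using abs_cos_le_one[of "s * c"] abs_cos_le_one[of "s * d"] by linarith
  then show "\<bar>integral {c..d} (\<lambda>t. sin (s * t))\<bar> \<le> 2 / s"
    using assms(1) by (simp add: integral_unique[OF *] abs_divide divide_right_mono)
qed

text \<open>
  The bound is uniform in the frequency \<open>s\<close>. Up to the time \<open>1 / s\<close> the factor \<open>|sin (s * t)| \<le> s * t\<close>
  turns the integrand into at most \<open>s * M\<close>; after it, the second mean value theorem pulls out
  \<open>h (1 / s) \<le> s * M\<close> and leaves the integral of a sine, which is at most \<open>2 / s\<close>. The function \<open>h\<close>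
  itself may behave like \<open>M / t\<close> at \<open>0\<close>. Negative frequencies follow because the sine is odd.
\<close>

lemma abs_sine_transform_le:
  fixes h :: "real \<Rightarrow> real"
  assumes [measurable]: "h \<in> borel_measurable borel"
    and anti: "antimono_on {0<..} h"
    and nonneg: "\<And>t. t > 0 \<Longrightarrow> 0 \<le> h t"
    and le: "\<And>t. t > 0 \<Longrightarrow> t * h t \<le> M"
    and zero: "\<And>t. t \<ge> T \<Longrightarrow> h t = 0"
  shows "\<bar>LINT t|lborel. indicator {0<..} t * (sin (s * t) * h t)\<bar> \<le> 3 * M"
proof -
  have M: "0 \<le> M"
    using nonneg[of 1] le[of 1] by simp
  have pos: "\<bar>LINT t|lborel. indicator {0<..} t * (sin (s * t) * h t)\<bar> \<le> 3 * M" if s: "s > 0" for s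
  proof -
    \<comment> \<open>\<open>h\<close> vanishes at \<open>b\<close>, which removes the second boundary term of the mean value theorem.\<close>
    define a b where "a = 1 / s" and "b = max T a + 1"
    have ab: "0 < a" "a \<le> b" "T \<le> b"
      using s by (auto simp: a_def b_def)
    define q where "q t = sin (s * t) * h t" for t
    have [measurable]: "q \<in> borel_measurable borel"
      unfolding q_def by measurable
    have q_le: "\<bar>q t\<bar> \<le> s * M" if "t > 0" for t
    proof -
      have "\<bar>q t\<bar> \<le> (s * t) * h t"
        unfolding q_def abs_mult using that s nonneg[OF that] abs_sin_x_le_abs_x[of "s * t"]
        by (intro mult_mono) auto
      also have "\<dots> \<le> s * M"
        using mult_left_mono[OF le[OF that], of s] s by (simp add: mult.assoc)
      finally show ?thesis .
    qed
    have int: "set_integrable lborel A q" if "A \<subseteq> {0<..b}" "A \<in> sets borel" for A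
      unfolding set_integrable_def
    proof (rule integrableI_bounded_set[where A = "{0..b}" and B = "s * M"])
      show "AE x in lborel. x \<in> {0..b} \<longrightarrow> norm (indicator A x *\<^sub>R q x) \<le> s * M"
        using that q_le s M by (intro AE_I2) (auto simp: indicator_def)
      show "AE x in lborel. x \<notin> {0..b} \<longrightarrow> indicat_real A x *\<^sub>R q x = 0"
        using that by (intro AE_I2) (auto simp: indicator_def)
    qed (use that ab in \<open>auto simp: emeasure_lborel_Icc_eq\<close>)
    have sub: "{0<..<a} \<subseteq> {0<..b}" "{a..b} \<subseteq> {0<..b}"
      using ab by auto
    have "(LINT t|lborel. indicator {0<..} t * (sin (s * t) * h t))
      = (LINT t|lborel. indicator {0<..<a} t *\<^sub>R q t + indicator {a..b} t *\<^sub>R q t)"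
      using ab zero by (intro Bochner_Integration.integral_cong) (auto simp: indicator_def q_def)
    also have "\<dots> = (LINT t:{0<..<a}|lborel. q t) + (LINT t:{a..b}|lborel. q t)"
      using int[OF sub(1)] int[OF sub(2)] unfolding set_lebesgue_integral_def set_integrable_def
      by (subst Bochner_Integration.integral_add) auto
    also have "(LINT t:{a..b}|lborel. q t) = integral {a..b} q"
      using int[OF sub(2)] by (intro set_borel_integral_eq_integral) auto
    finally have split: "(LINT t|lborel. indicator {0<..} t * (sin (s * t) * h t))
      = (LINT t:{0<..<a}|lborel. q t) + integral {a..b} q" .
    have "\<bar>LINT t:{0<..<a}|lborel. q t\<bar> \<le> (LINT t|lborel. indicator {0<..<a} t * (s * M))"
      unfolding set_lebesgue_integral_def real_norm_def[symmetric]
    proof (rule Bochner_Integration.integral_norm_bound_integral)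
      show "norm (indicator {0<..<a} t *\<^sub>R q t) \<le> indicator {0<..<a} t * (s * M)" for t
        using q_le[of t] by (auto simp: indicator_def)
    qed (use int[OF sub(1)] ab in \<open>auto simp: set_integrable_def intro!: integrable_mult_left\<close>)
    also have "\<dots> = M"
      using ab s by (simp add: a_def)
    finally have near: "\<bar>LINT t:{0<..<a}|lborel. q t\<bar> \<le> M" .
    \<comment> \<open>The mean value theorem is stated for increasing weights, hence the sign of \<open>h\<close>.\<close>
    obtain c where c: "c \<in> {a..b}" and
      "integral {a..b} (\<lambda>t. - h t * sin (s * t))
        = - h a * integral {a..c} (\<lambda>t. sin (s * t)) + - h b * integral {c..b} (\<lambda>t. sin (s * t))"
    proof (rule second_mean_value_theorem[of "\<lambda>t. sin (s * t)" a b "\<lambda>t. - h t"])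
      show "(\<lambda>t. sin (s * t)) integrable_on {a..b}"
        using integral_sin_le_two_over(1)[OF s ab(2)] by blast
      show "- h x \<le> - h y" if "a \<le> x" "x \<le> y" "y \<le> b" for x y
        using that ab monotone_onD[OF anti, of x y] by auto
    qed (use ab in auto)
    then have "integral {a..b} q = h a * integral {a..c} (\<lambda>t. sin (s * t))"
      using zero[OF ab(3)] by (simp add: q_def[abs_def] mult.commute)
    then have "\<bar>integral {a..b} q\<bar> = h a * \<bar>integral {a..c} (\<lambda>t. sin (s * t))\<bar>"
      using nonneg[OF ab(1)] by (simp add: abs_mult)
    also have "\<dots> \<le> h a * (2 / s)"
      using c nonneg[OF ab(1)] by (intro mult_left_mono integral_sin_le_two_over(2)[OF s]) auto
    also have "\<dots> \<le> 2 * M"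
      using mult_left_mono[OF le[OF ab(1)], of 2] by (simp add: a_def mult.commute)
    finally show ?thesis
      using near split by linarith
  qed
  consider "s > 0" | "s = 0" | "- s > 0" by linarith
  then show ?thesis
  proof cases
    case 3
    have "(LINT t|lborel. indicator {0<..} t * (sin (s * t) * h t))
        = (LINT t|lborel. - (indicator {0<..} t * (sin (- s * t) * h t)))"
      by (intro Bochner_Integration.integral_cong) auto
    then show ?thesis
      using pos[OF 3] by simp
  qed (use pos M in auto)
qed

text \<open>
  For \<open>c \<noteq> 0\<close> both integrands are integrable or neither is, and in the latter case both integrals are
  \<open>0\<close> by convention. The equation is thus available on every ray, including the null set of rays on
  which Fubini's theorem guarantees nothing.
\<close>

lemma integral_scaleR_constant:
  fixes c :: "'a::euclidean_space"
  shows "(LINT x|M. f x *\<^sub>R c) = (LINT x|M. f x) *\<^sub>R c"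
proof (cases "integrable M f \<or> c = 0")
  case False
  have "integrable M f" if "integrable M (\<lambda>x. f x *\<^sub>R c)"
    using integrable_mult_left[OF integrable_inner_left[OF that, of c], of "inverse (c \<bullet> c)"] False
    by (simp add: mult.assoc)
  then show ?thesis
    using False not_integrable_integral_eq[of M "\<lambda>x. f x *\<^sub>R c"] not_integrable_integral_eq[of M f] by auto
qed auto

text \<open>
  On the ray \<open>t \<mapsto> t w\<close> the Jacobian \<open>t ^ (n - 1)\<close>, the factor \<open>t\<close> of the vector \<open>t w\<close> and the
  denominator cancel, so that what remains is the sine transform of \<open>t \<mapsto> f (|w| t)\<close> at the
  frequency \<open>w \<bullet> e\<close>. The bound on that transform is uniform in the frequency, hence so is this one
  in \<open>e\<close>.
\<close>

lemma oscillatory_kernel_integral_le: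
  fixes f :: "real \<Rightarrow> real" and e :: "'a::euclidean_space"
  defines "A \<equiv> {w::'a. 1 \<le> norm w \<and> norm w \<le> 2}"
  assumes [measurable]: "f \<in> borel_measurable borel"
    and anti: "antimono_on {0<..} f"
    and nonneg: "\<And>t. t > 0 \<Longrightarrow> 0 \<le> f t"
    and le: "\<And>t. t > 0 \<Longrightarrow> t * f t \<le> M"
    and zero: "\<And>t. t \<ge> T \<Longrightarrow> f t = 0"
    and int: "integrable lborel (\<lambda>z. sin (z \<bullet> e) *\<^sub>R (f (norm z) / norm z ^ DIM('a)) *\<^sub>R z)"
  shows "norm (LINT z|lborel. sin (z \<bullet> e) *\<^sub>R (f (norm z) / norm z ^ DIM('a)) *\<^sub>R z) \<le> 3 / ln 2 * measure lborel A * M"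
proof -
  have M: "0 \<le> M"
    using nonneg[of 1] le[of 1] by simp
  have A: "A \<in> sets borel" "emeasure lborel A < \<infinity>"
  proof -
    show "A \<in> sets borel" unfolding A_def by measurable
    have "A \<subseteq> cball 0 2" by (auto simp: A_def)
    then have "emeasure lborel A \<le> emeasure lborel (cball (0::'a) 2)"
      by (intro emeasure_mono) auto
    then show "emeasure lborel A < \<infinity>"
      using emeasure_lborel_cball_finite[of "0::'a" 2] by (auto simp: less_top[symmetric] top_unique)
  qed
  define F where "F z = sin (z \<bullet> e) *\<^sub>R (f (norm z) / norm z ^ DIM('a)) *\<^sub>R z" for z
  define L where "L w = (LINT t|lborel. (indicator A w * indicator {0<..} t * t ^ (DIM('a) - 1)) *\<^sub>R F (t *\<^sub>R w))" for w
  have L_le: "norm (L w) \<le> indicator A w * (3 * M)" for w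
  proof (cases "w \<in> A")
    case True
    then have w: "1 \<le> norm w" by (simp add: A_def)
    have wt: "0 < norm w * t" if "t > 0" for t
      using w that by (intro mult_pos_pos) auto
    have pw: "(indicator A w * indicator {0<..} t * t ^ (DIM('a) - 1)) *\<^sub>R F (t *\<^sub>R w)
      = (indicator {0<..} t * (sin ((w \<bullet> e) * t) * f (norm w * t))) *\<^sub>R (inverse (norm w ^ DIM('a)) *\<^sub>R w)" for t
    proof (cases "t > 0")
      case pos: True
      have "t ^ DIM('a) = t ^ (DIM('a) - 1) * t"
        using DIM_positive[where 'a='a] by (metis power_minus_mult)
      then have coeff: "t ^ (DIM('a) - 1) * (sin (t * (w \<bullet> e)) * (f (t * norm w) / (t * norm w) ^ DIM('a) * t))
          = sin (t * (w \<bullet> e)) * f (t * norm w) * inverse (norm w ^ DIM('a))"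
        using pos by (simp add: power_mult_distrib divide_simps)
      have "(indicator A w * indicator {0<..} t * t ^ (DIM('a) - 1)) *\<^sub>R F (t *\<^sub>R w)
          = (t ^ (DIM('a) - 1) * (sin (t * (w \<bullet> e)) * (f (t * norm w) / (t * norm w) ^ DIM('a) * t))) *\<^sub>R w"
        using pos True by (simp add: F_def)
      also have "\<dots> = (indicator {0<..} t * (sin ((w \<bullet> e) * t) * f (norm w * t))) *\<^sub>R (inverse (norm w ^ DIM('a)) *\<^sub>R w)"
        unfolding coeff using pos by (simp add: mult.commute[of t])
      finally show ?thesis .
    qed (auto simp: indicator_def)
    have "\<bar>LINT t|lborel. indicator {0<..} t * (sin ((w \<bullet> e) * t) * f (norm w * t))\<bar> \<le> 3 * M"
    proof (rule abs_sine_transform_le[where T = "max T 0"])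
      show "antimono_on {0<..} (\<lambda>t. f (norm w * t))"
        using w by (intro monotone_onI monotone_onD[OF anti]) (auto intro!: mult_pos_pos mult_left_mono)
      show "t * f (norm w * t) \<le> M" if "t > 0" for t
      proof -
        have "1 * (t * f (norm w * t)) \<le> norm w * (t * f (norm w * t))"
          using w that nonneg[OF wt[OF that]] by (intro mult_right_mono) auto
        also have "\<dots> \<le> M"
          using le[OF wt[OF that]] by (simp add: mult.assoc)
        finally show ?thesis by simp
      qed
      show "f (norm w * t) = 0" if "max T 0 \<le> t" for t
        using that mult_right_mono[OF w, of t] by (intro zero) auto
      show "0 \<le> f (norm w * t)" if "t > 0" for t
        using that by (intro nonneg wt)
    qed measurable
    moreover have "norm (inverse (norm w ^ DIM('a)) *\<^sub>R w) \<le> 1"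
    proof -
      have "norm w ^ 1 \<le> norm w ^ DIM('a)"
        using w DIM_positive[where 'a='a] by (intro power_increasing) auto
      then show ?thesis
        using w by (simp add: divide_simps inverse_eq_divide)
    qed
    ultimately have "\<bar>LINT t|lborel. indicator {0<..} t * (sin ((w \<bullet> e) * t) * f (norm w * t))\<bar>
        * norm (inverse (norm w ^ DIM('a)) *\<^sub>R w) \<le> 3 * M * 1"
      using M by (intro mult_mono) auto
    then show ?thesis
      unfolding L_def pw integral_scaleR_constant using True by (simp add: abs_mult mult.assoc)
  qed (simp add: L_def)
  have rays: "ln 2 *\<^sub>R (LINT z|lborel. F z) = (LINT w|lborel. L w)" "integrable lborel L"
    using integral_rays[of F] int unfolding L_def F_def[symmetric] A_def by auto
  have "ln 2 * norm (LINT z|lborel. F z) = norm (LINT w|lborel. L w)"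
    unfolding rays(1)[symmetric] by simp
  also have "\<dots> \<le> (LINT w|lborel. indicator A w * (3 * M))"
    using A L_le rays(2) by (intro Bochner_Integration.integral_norm_bound_integral) auto
  also have "\<dots> = measure lborel A * (3 * M)"
    using A by simp
  finally show ?thesis
    by (simp add: F_def field_simps)
qed

text \<open>
  A translation by half a period changes the sign of the sine, so that twice the integral is the
  oscillation of \<open>h\<close> minus its translate. Translates converge to \<open>h\<close> pointwise where \<open>h\<close> is
  continuous and have the same norm in \<open>L\<^sup>1\<close>, so Scheffe's lemma gives convergence in \<open>L\<^sup>1\<close>. The
  free phase \<open>\<theta>\<close> covers cosines, and oscillations whose origin moves with \<open>k\<close>.
\<close>

proposition riemann_lebesgue:
  fixes h :: "'a::euclidean_space \<Rightarrow> 'b::{banach, second_countable_topology}"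
  assumes h: "integrable lborel h" and cont: "AE z in lborel. isCont h z" and e: "norm e = 1"
  shows "(\<lambda>k. LINT z|lborel. sin (real k * (z \<bullet> e) + \<theta> k) *\<^sub>R h z) \<longlonglongrightarrow> 0"
proof -
  have [measurable]: "h \<in> borel_measurable borel"
    using h by auto
  define a where "a k = (pi / real k) *\<^sub>R e" for k
  have a0: "a \<longlonglongrightarrow> 0"
    unfolding a_def by (auto intro!: tendsto_eq_intros lim_const_over_n)
  have int_shift: "integrable lborel (\<lambda>z. h (z + a k))" for k
    by (rule integrable_lborel_shift[OF h])
  have "(\<lambda>k. \<integral>\<^sup>+ z. norm (h (z + a k) - h z) \<partial>lborel) \<longlonglongrightarrow> 0"
  proof (rule Scheffe_lemma2)
    show "AE z in lborel. (\<lambda>k. h (z + a k)) \<longlonglongrightarrow> h z"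
      using cont
    proof eventually_elim
      case (elim z)
      then show ?case
        by (rule isCont_tendsto_compose) (use tendsto_add[OF tendsto_const a0, of z] in simp)
    qed
    show "(\<integral>\<^sup>+ z. norm (h (z + a k)) \<partial>lborel) \<le> (\<integral>\<^sup>+ z. norm (h z) \<partial>lborel)" for k
    proof -
      have "(\<integral>\<^sup>+ z. norm (h (z + a k)) \<partial>lborel) = ennreal (LINT z|lborel. norm (h (z + a k)))"
        using int_shift[of k] by (intro nn_integral_eq_integral) auto
      also have "(LINT z|lborel. norm (h (z + a k))) = (LINT z|lborel. norm (h z))"
        by (rule integral_lborel_shift) measurable
      also have "ennreal (LINT z|lborel. norm (h z)) = (\<integral>\<^sup>+ z. norm (h z) \<partial>lborel)"
        using h by (intro nn_integral_eq_integral[symmetric]) auto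
      finally show ?thesis by simp
    qed
  qed (use h in auto)
  moreover have "(\<integral>\<^sup>+ z. norm (h (z + a k) - h z) \<partial>lborel) = ennreal (LINT z|lborel. norm (h (z + a k) - h z))" for k
    using h int_shift[of k] by (intro nn_integral_eq_integral) auto
  ultimately have lim: "(\<lambda>k. LINT z|lborel. norm (h (z + a k) - h z)) \<longlonglongrightarrow> 0"
    by (simp add: tendsto_ennreal_iff flip: ennreal_0)
  show ?thesis
  proof (rule Lim_null_comparison[OF _ lim])
    show "\<forall>\<^sub>F k in sequentially. norm (LINT z|lborel. sin (real k * (z \<bullet> e) + \<theta> k) *\<^sub>R h z)
        \<le> (LINT z|lborel. norm (h (z + a k) - h z))"
      using eventually_gt_at_top[of 0]
    proof eventually_elim
      case (elim k)
      define s where "s z = sin (real k * (z \<bullet> e) + \<theta> k)" for z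
      have [measurable]: "s \<in> borel_measurable borel"
        unfolding s_def by measurable
      have "a k \<bullet> e = pi / real k"
        using e by (simp add: a_def power2_norm_eq_inner[symmetric])
      then have s_shift: "s (z + a k) = - s z" for z
      proof -
        have "real k * ((z + a k) \<bullet> e) + \<theta> k = (real k * (z \<bullet> e) + \<theta> k) + pi"
          using elim \<open>a k \<bullet> e = pi / real k\<close> by (simp add: inner_add_left distrib_left)
        then show ?thesis
          unfolding s_def by (simp only: sin_periodic_pi)
      qed
      have s_le: "\<bar>s z\<bar> \<le> 1" for z
        by (simp add: s_def)
      have int: "integrable lborel (\<lambda>z. s z *\<^sub>R g z)" if "integrable lborel g" for g :: "'a \<Rightarrow> 'b"
        using that s_le by (intro Bochner_Integration.integrable_bound[OF that])
          (auto intro!: AE_I2 mult_left_le_one_le)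
      have "(LINT z|lborel. s z *\<^sub>R h z) = (LINT z|lborel. s (z + a k) *\<^sub>R h (z + a k))"
        by (rule integral_lborel_shift[symmetric]) measurable
      also have "\<dots> = - (LINT z|lborel. s z *\<^sub>R h (z + a k))"
        by (simp add: s_shift)
      finally have "2 *\<^sub>R (LINT z|lborel. s z *\<^sub>R h z) = (LINT z|lborel. s z *\<^sub>R h z) - (LINT z|lborel. s z *\<^sub>R h (z + a k))"
        by (simp add: scaleR_2)
      also have "\<dots> = (LINT z|lborel. s z *\<^sub>R (h z - h (z + a k)))"
        using int[OF h] int[OF int_shift] by (simp add: scaleR_diff_right)
      finally have "2 * norm (LINT z|lborel. s z *\<^sub>R h z) = norm (LINT z|lborel. s z *\<^sub>R (h z - h (z + a k)))"
        by (metis abs_numeral norm_scaleR)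
      also have "\<dots> \<le> (LINT z|lborel. norm (h (z + a k) - h z))"
      proof (rule Bochner_Integration.integral_norm_bound_integral)
        show "norm (s z *\<^sub>R (h z - h (z + a k))) \<le> norm (h (z + a k) - h z)" for z
          using mult_left_le_one_le[of "norm (h z - h (z + a k))" "\<bar>s z\<bar>"] s_le
          by (simp add: norm_minus_commute)
      qed (use int[of "\<lambda>z. h z - h (z + a k)"] h int_shift[of k] in auto)
      finally show ?case
        using norm_ge_zero[of "LINT z|lborel. s z *\<^sub>R h z"] unfolding s_def by linarith
    qed
  qed
qed

section \<open>The nonlocal gradient of a Lipschitz function\<close>

text \<open>
  The vector field \<open>K\<close> against which differences are integrated, both in the divergence and in the
  gradient. It vanishes at the origin because \<open>z\<close> does, so an infinite value of \<open>\<rho>\<close> there is harmless.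
\<close>

definition gradient_kernel :: "('a::euclidean_space \<Rightarrow> real) \<Rightarrow> 'a \<Rightarrow> 'a" where
  "gradient_kernel R z = (R z / (norm z)\<^sup>2) *\<^sub>R z"

definition nonlocal_grad :: "('a::euclidean_space \<Rightarrow> real) \<Rightarrow> ('a \<Rightarrow> real) \<Rightarrow> 'a \<Rightarrow> 'a" where
  "nonlocal_grad R u x = (LINT z|lborel. (u x - u (x - z)) *\<^sub>R gradient_kernel R z)"

text \<open>
  What the duality of gradient and divergence uses about a test function. The Lipschitz bound comes
  from the partial derivatives, which are continuous and vanish off the support.
\<close>

lemma test_function_regular:
  fixes \<Phi> :: "'a::euclidean_space \<Rightarrow> 'b::euclidean_space"
  assumes "\<Phi> \<in> test_functions"
  obtains L B where "L-lipschitz_on UNIV \<Phi>" "integrable lborel \<Phi>" "\<And>x. norm (\<Phi> x) \<le> B"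
proof -
  have compact: "compact (support \<Phi>)" and Ck: "Ck k \<Phi>" for k
    using assms by (auto simp: test_functions_def)
  have cont: "continuous_on UNIV \<Phi>"
    using Ck[of 0] by simp
  have deriv: "(\<Phi> has_derivative frechet_derivative \<Phi> (at x)) (at x)" for x
    using Ck[of 1] by (simp add: frechet_derivative_works)
  have deriv_cont: "continuous_on UNIV (\<lambda>x. frechet_derivative \<Phi> (at x) v)" for v
    using Ck[of 1] by simp
  have zero: "\<Phi> x = 0" if "x \<notin> support \<Phi>" for x
    using that closure_subset[of "{x. \<Phi> x \<noteq> 0}"] unfolding support_def by auto
  have deriv_zero: "frechet_derivative \<Phi> (at x) v = 0" if "x \<notin> support \<Phi>" for x v
  proof -
    have "open (- support \<Phi>)"
      unfolding support_def by (intro open_Compl closed_closure)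
    then have "(\<Phi> has_derivative (\<lambda>_. 0)) (at x)"
      using that zero by (intro has_derivative_transform_within_open[OF has_derivative_const[of 0]]) auto
    then show ?thesis
      using has_derivative_unique[OF deriv] by metis
  qed
  have bdd: "\<exists>B\<ge>0. \<forall>x. norm (g x) \<le> B" if "continuous_on UNIV g" "\<And>x. x \<notin> support \<Phi> \<Longrightarrow> g x = 0" for g :: "'a \<Rightarrow> 'b"
  proof -
    have "compact (g ` support \<Phi>)"
      using compact that(1) by (intro compact_continuous_image) (auto intro: continuous_on_subset)
    then obtain B where "B > 0" "\<And>y. y \<in> g ` support \<Phi> \<Longrightarrow> norm y \<le> B"
      using compact_imp_bounded bounded_pos by metis
    then show ?thesis
      using that(2) by (intro exI[of _ B]) (metis imageI less_imp_le norm_zero)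
  qed
  have "\<forall>v. \<exists>B. 0 \<le> B \<and> (\<forall>x. norm (frechet_derivative \<Phi> (at x) v) \<le> B)"
    using bdd[OF deriv_cont deriv_zero] by blast
  then obtain D where D: "\<And>v. 0 \<le> D v" "\<And>x v. norm (frechet_derivative \<Phi> (at x) v) \<le> D v"
    by metis
  have "norm (frechet_derivative \<Phi> (at x) v) \<le> (\<Sum>b\<in>Basis. D b) * norm v" for x v
  proof -
    interpret linear "frechet_derivative \<Phi> (at x)"
      using deriv has_derivative_linear by blast
    have "norm (frechet_derivative \<Phi> (at x) v) = norm (\<Sum>b\<in>Basis. (v \<bullet> b) *\<^sub>R frechet_derivative \<Phi> (at x) b)"
      by (metis (no_types, lifting) euclidean_representation scale sum sum.cong)
    also have "\<dots> \<le> (\<Sum>b\<in>Basis. D b * norm v)"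
    proof (rule order_trans[OF norm_sum sum_mono])
      fix b :: 'a assume "b \<in> Basis"
      then have "\<bar>v \<bullet> b\<bar> * norm (frechet_derivative \<Phi> (at x) b) \<le> norm v * D b"
        using D by (intro mult_mono Basis_le_norm) auto
      then show "norm ((v \<bullet> b) *\<^sub>R frechet_derivative \<Phi> (at x) b) \<le> D b * norm v"
        by (simp add: mult.commute)
    qed
    finally show ?thesis
      by (simp add: sum_distrib_right)
  qed
  then have "norm (\<Phi> x - \<Phi> y) \<le> (\<Sum>b\<in>Basis. D b) * norm (x - y)" for x y
    by (intro differentiable_bound[of UNIV \<Phi> "\<lambda>x. frechet_derivative \<Phi> (at x)"])
      (auto intro!: onorm_bound sum_nonneg D(1) has_derivative_at_withinI[OF deriv])
  then have lip: "(\<Sum>b\<in>Basis. D b)-lipschitz_on UNIV \<Phi>"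
    using D(1) by (intro lipschitz_onI) (auto simp: dist_norm intro: sum_nonneg)
  have "integrable lborel (\<lambda>x. indicator (support \<Phi>) x *\<^sub>R \<Phi> x)"
    using compact cont by (intro borel_integrable_compact) (auto intro: continuous_on_subset)
  moreover have "(\<lambda>x. indicator (support \<Phi>) x *\<^sub>R \<Phi> x) = \<Phi>"
    using zero by (auto simp: indicator_def)
  ultimately have "integrable lborel \<Phi>"
    by simp
  moreover obtain B where "\<And>x. norm (\<Phi> x) \<le> B"
    using bdd[OF cont zero] by blast
  ultimately show thesis
    using lip that by blast
qed

locale even_kernel =
  fixes R :: "'a::euclidean_space \<Rightarrow> real"
  assumes nonneg: "0 \<le> R z"
    and even: "R (- z) = R z"
    and integrable: "integrable lborel R"
begin

lemma borel_R [measurable]: "R \<in> borel_measurable borel"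
  using integrable by auto

lemma borel_kernel [measurable]: "gradient_kernel R \<in> borel_measurable borel"
  unfolding gradient_kernel_def by measurable

lemma kernel_odd: "gradient_kernel R (- z) = - gradient_kernel R z"
  by (simp add: gradient_kernel_def even)

lemma norm_kernel: "norm (gradient_kernel R z) = R z / norm z"
  using nonneg[of z] by (simp add: gradient_kernel_def power2_eq_square)

text \<open>
  The kernel is too singular to be integrable, but a factor that vanishes linearly at the origin,
  such as a difference of a Lipschitz function, brings it down to \<open>R\<close>.
\<close>

lemma scaleR_kernel_le:
  assumes "\<bar>c\<bar> \<le> L * norm z" "0 \<le> L"
  shows "norm (c *\<^sub>R gradient_kernel R z) \<le> L * R z"
proof (cases "z = 0")
  case True
  then show ?thesis
    using assms nonneg[of 0] by (simp add: gradient_kernel_def)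
next
  case False
  then show ?thesis
    using mult_right_mono[OF assms(1), of "R z / norm z"] nonneg[of z] by (simp add: norm_kernel)
qed

end

lemma (in even_kernel) nonlocal_div_eq:
  assumes \<rho>: "\<And>z. enn2real (\<rho> z) = R z" and "continuous_on UNIV \<Phi>"
  shows "nonlocal_div \<rho> \<Phi> x = (LINT z|lborel. (\<Phi> x - \<Phi> (x - z)) \<bullet> gradient_kernel R z)"
proof -
  have [measurable]: "\<Phi> \<in> borel_measurable borel"
    using assms(2) by (rule borel_measurable_continuous_onI)
  define G where "G z = (\<Phi> x - \<Phi> (x - z)) \<bullet> gradient_kernel R z" for z
  have [measurable]: "G \<in> borel_measurable borel"
    unfolding G_def by measurable
  have "nonlocal_div \<rho> \<Phi> x = (LINT y|lebesgue. G (x - y))"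
    unfolding nonlocal_div_def
    by (intro Bochner_Integration.integral_cong)
      (auto simp: G_def \<rho> gradient_kernel_def power2_eq_square divide_inverse algebra_simps)
  also have "\<dots> = (LINT y|lborel. G (x - y))"
    by (rule integral_completion) measurable
  also have "\<dots> = (LINT z|lborel. G z)"
    by (rule integral_lborel_reflect) measurable
  finally show ?thesis
    unfolding G_def .
qed

text \<open>
  The divergence places the difference on \<open>\<Phi>\<close>. The Lipschitz bounds make all double integrals
  absolutely convergent; for fixed \<open>z\<close> a translation in \<open>x\<close> moves the difference from \<open>\<Phi>\<close> to \<open>u\<close>,
  at the price of replacing \<open>z\<close> by \<open>- z\<close>, and that reflection is undone by the oddness of the kernel,
  which also accounts for the sign in the definition of the weak gradient.
\<close>

lemma (in even_kernel) weak_grad_eq: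
  assumes \<rho>: "\<And>z. enn2real (\<rho> z) = R z"
    and u: "L-lipschitz_on UNIV u" "integrable lborel u"
    and \<Phi>: "L'-lipschitz_on UNIV \<Phi>" "integrable lborel \<Phi>" "\<And>x. norm (\<Phi> x) \<le> B"
  shows "weak_grad \<rho> u \<Phi> = (LINT x|lebesgue. nonlocal_grad R u x \<bullet> \<Phi> x)"
proof -
  let ?K = "gradient_kernel R"
  have cont: "continuous_on UNIV \<Phi>"
    using \<Phi>(1) by (rule lipschitz_on_continuous_on)
  have [measurable]: "u \<in> borel_measurable borel" "\<Phi> \<in> borel_measurable borel"
    using u(2) \<Phi>(2) by auto
  define P where "P x z = u x * ((\<Phi> x - \<Phi> (x - z)) \<bullet> ?K z)" for x z
  define Q where "Q x z = ((u x - u (x - z)) *\<^sub>R ?K z) \<bullet> \<Phi> x" for x z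
  have [measurable]: "(\<lambda>(x, z). P x z) \<in> borel_measurable (lborel \<Otimes>\<^sub>M lborel)"
      "(\<lambda>(x, z). Q x z) \<in> borel_measurable (lborel \<Otimes>\<^sub>M lborel)"
    unfolding P_def Q_def by measurable
  have u_le: "norm ((u x - u (x - z)) *\<^sub>R ?K z) \<le> L * R z" for x z
    using lipschitz_onD[OF u(1), of x "x - z"] lipschitz_on_nonneg[OF u(1)] by (intro scaleR_kernel_le) (simp add: dist_real_def dist_norm)
  have "norm (P x z) \<le> norm (u x) * (L' * R z)" for x z
  proof -
    have "norm ((\<Phi> x - \<Phi> (x - z)) \<bullet> ?K z) \<le> norm (norm (\<Phi> x - \<Phi> (x - z)) *\<^sub>R ?K z)"
      using Cauchy_Schwarz_ineq2[of "\<Phi> x - \<Phi> (x - z)" "?K z"] by simp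
    also have "\<dots> \<le> L' * R z"
      using lipschitz_onD[OF \<Phi>(1), of x "x - z"] lipschitz_on_nonneg[OF \<Phi>(1)] by (intro scaleR_kernel_le) (simp add: dist_norm)
    finally show ?thesis
      unfolding P_def norm_mult by (intro mult_left_mono) auto
  qed
  then have int_P: "integrable (lborel \<Otimes>\<^sub>M lborel) (\<lambda>(x, z). P x z)"
    using u(2) integrable by (intro integrable_pair_dominated[where f="\<lambda>x. norm (u x)" and g="\<lambda>z. L' * R z"]) auto
  have "norm (Q x z) \<le> norm (\<Phi> x) * (L * R z)" for x z
    using Cauchy_Schwarz_ineq2[of "(u x - u (x - z)) *\<^sub>R ?K z" "\<Phi> x"] mult_right_mono[OF u_le[of x z], of "norm (\<Phi> x)"]
    unfolding Q_def real_norm_def by (simp only: mult.commute) (meson norm_ge_zero order_trans)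
  then have int_Q: "integrable (lborel \<Otimes>\<^sub>M lborel) (\<lambda>(x, z). Q x z)"
    using \<Phi>(2) integrable by (intro integrable_pair_dominated[where f="\<lambda>x. norm (\<Phi> x)" and g="\<lambda>z. L * R z"]) auto
  \<comment> \<open>The discrete integration by parts: translation by \<open>z\<close> under the integral over \<open>x\<close>.\<close>
  have transpose: "- (LINT x|lborel. P x (- z)) = (LINT x|lborel. Q x z)" for z
  proof -
    define p where "p x = u x * (\<Phi> x \<bullet> ?K z)" for x
    define q where "q x = u x * (\<Phi> (x + z) \<bullet> ?K z)" for x
    have int: "integrable lborel (\<lambda>x. u x * (\<Psi> x \<bullet> ?K z))" if "\<Psi> \<in> borel_measurable borel" "\<And>x. norm (\<Psi> x) \<le> B" for \<Psi>
    proof (rule Bochner_Integration.integrable_bound)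
      show "integrable lborel (\<lambda>x. (B * norm (?K z)) * u x)"
        using u(2) by simp
      show "AE x in lborel. norm (u x * (\<Psi> x \<bullet> ?K z)) \<le> norm ((B * norm (?K z)) * u x)"
      proof (rule AE_I2)
        fix x
        have "\<bar>\<Psi> x \<bullet> ?K z\<bar> \<le> B * norm (?K z)"
          using Cauchy_Schwarz_ineq2[of "\<Psi> x" "?K z"] mult_right_mono[OF that(2)[of x], of "norm (?K z)"] by simp
        then have "\<bar>\<Psi> x \<bullet> ?K z\<bar> \<le> \<bar>B * norm (?K z)\<bar>"
          by linarith
        then show "norm (u x * (\<Psi> x \<bullet> ?K z)) \<le> norm ((B * norm (?K z)) * u x)"
          unfolding norm_mult real_norm_def abs_mult[symmetric] by (subst mult.commute) (simp add: abs_mult mult_right_mono)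
      qed
    qed (use that in measurable)
    have p: "integrable lborel p" and q: "integrable lborel q"
      unfolding p_def q_def using \<Phi>(3) by (auto intro!: int)
    have "- (LINT x|lborel. P x (- z)) = (LINT x|lborel. p x - q x)"
      by (subst Bochner_Integration.integral_minus[symmetric])
        (simp add: P_def p_def q_def kernel_odd inner_diff_left algebra_simps)
    also have "\<dots> = (LINT x|lborel. p x) - (LINT x|lborel. q (x + - z))"
      using p q integral_lborel_shift[of q "- z"] by simp
    also have "\<dots> = (LINT x|lborel. p x - q (x + - z))"
      using p integrable_lborel_shift[OF q, of "- z"] by simp
    also have "\<dots> = (LINT x|lborel. Q x z)"
      by (simp add: Q_def p_def q_def inner_commute algebra_simps)
    finally show ?thesis .
  qed
  have "weak_grad \<rho> u \<Phi> = - (LINT x|lebesgue. LINT z|lborel. P x z)"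
    unfolding weak_grad_def nonlocal_div_eq[OF \<rho> cont] P_def by simp
  also have "\<dots> = - (LINT x|lborel. LINT z|lborel. P x z)"
    by (subst integral_completion) auto
  also have "\<dots> = - (LINT z|lborel. LINT x|lborel. P x z)"
    by (simp add: lborel_pair.Fubini_integral[OF int_P])
  also have "\<dots> = - (LINT z|lborel. LINT x|lborel. P x (- z))"
    using integral_lborel_reflect[of "\<lambda>z. LINT x|lborel. P x z" 0] by simp
  also have "\<dots> = (LINT z|lborel. LINT x|lborel. Q x z)"
    unfolding transpose[symmetric] by simp
  also have "\<dots> = (LINT x|lborel. LINT z|lborel. Q x z)"
    by (rule lborel_pair.Fubini_integral[OF int_Q])
  also have "\<dots> = (LINT x|lborel. nonlocal_grad R u x \<bullet> \<Phi> x)"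
  proof (rule Bochner_Integration.integral_cong)
    fix x
    have "integrable lborel (\<lambda>z. (u x - u (x - z)) *\<^sub>R ?K z)"
    proof (rule Bochner_Integration.integrable_bound)
      show "integrable lborel (\<lambda>z. L * R z)"
        using integrable by simp
      show "AE z in lborel. norm ((u x - u (x - z)) *\<^sub>R ?K z) \<le> norm (L * R z)"
        unfolding real_norm_def by (intro AE_I2 order_trans[OF u_le abs_ge_self])
    qed measurable
    then show "(LINT z|lborel. Q x z) = nonlocal_grad R u x \<bullet> \<Phi> x"
      unfolding Q_def nonlocal_grad_def by (intro integral_inner_left)
  qed simp
  also have "\<dots> = (LINT x|lebesgue. nonlocal_grad R u x \<bullet> \<Phi> x)"
    unfolding nonlocal_grad_def by (rule integral_completion[symmetric]) measurable
  finally show ?thesis .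
qed

section \<open>The Fourier symbol of the nonlocal gradient\<close>

locale compact_kernel = even_kernel R for R :: "'a::euclidean_space \<Rightarrow> real" +
  fixes S :: real
  assumes kernel_vanish: "S < norm z \<Longrightarrow> R z = 0"
    and kernel_cont: "z \<noteq> 0 \<Longrightarrow> isCont R z"
begin

lemma isCont_gradient_kernel: "z \<noteq> 0 \<Longrightarrow> isCont (gradient_kernel R) z"
  unfolding gradient_kernel_def by (intro continuous_intros kernel_cont) auto

text \<open>
  Applied to \<open>x \<mapsto> exp (\<i> (x \<bullet> \<xi>))\<close>, the nonlocal gradient multiplies by \<open>\<i>\<close> times this vector: the
  other half of \<open>1 - exp (- \<i> (z \<bullet> \<xi>))\<close> is even in \<open>z\<close> and integrates to \<open>0\<close> against the odd kernel.
\<close>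

definition symbol :: "'a \<Rightarrow> 'a" where
  "symbol \<xi> = (LINT z|lborel. sin (z \<bullet> \<xi>) *\<^sub>R gradient_kernel R z)"

lemma integrable_scaleR_kernel:
  assumes [measurable]: "c \<in> borel_measurable borel" and "\<And>z. \<bar>c z\<bar> \<le> L * norm z" "0 \<le> L"
  shows "integrable lborel (\<lambda>z. c z *\<^sub>R gradient_kernel R z)"
proof (rule Bochner_Integration.integrable_bound)
  show "integrable lborel (\<lambda>z. L * R z)"
    using integrable by simp
  show "AE z in lborel. norm (c z *\<^sub>R gradient_kernel R z) \<le> norm (L * R z)"
    unfolding real_norm_def by (intro AE_I2 order_trans[OF scaleR_kernel_le abs_ge_self] assms)
qed measurable

lemma integrable_sin_kernel: "integrable lborel (\<lambda>z. sin (z \<bullet> \<xi>) *\<^sub>R gradient_kernel R z)"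
proof (rule integrable_scaleR_kernel[where L = "norm \<xi>"])
  show "\<bar>sin (z \<bullet> \<xi>)\<bar> \<le> norm \<xi> * norm z" for z
    using order_trans[OF abs_sin_x_le_abs_x Cauchy_Schwarz_ineq2[of z \<xi>]] by (simp add: mult.commute)
qed auto

lemma integral_one_minus_cos_kernel:
  "integrable lborel (\<lambda>z. (1 - cos (z \<bullet> \<xi>)) *\<^sub>R gradient_kernel R z)"
  "(LINT z|lborel. (1 - cos (z \<bullet> \<xi>)) *\<^sub>R gradient_kernel R z) = 0" (is "?I = 0")
proof -
  show "integrable lborel (\<lambda>z. (1 - cos (z \<bullet> \<xi>)) *\<^sub>R gradient_kernel R z)"
  proof (rule integrable_scaleR_kernel[where L = "norm \<xi>"])
    show "\<bar>1 - cos (z \<bullet> \<xi>)\<bar> \<le> norm \<xi> * norm z" for z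
      using order_trans[OF abs_cos_diff_le[of 0 "z \<bullet> \<xi>"], of "norm \<xi> * norm z"] Cauchy_Schwarz_ineq2[of z \<xi>]
      by (simp add: mult.commute)
  qed auto
  have "?I = (LINT z|lborel. - ((1 - cos (z \<bullet> \<xi>)) *\<^sub>R gradient_kernel R z))"
    using integral_lborel_reflect[of "\<lambda>z. (1 - cos (z \<bullet> \<xi>)) *\<^sub>R gradient_kernel R z" 0]
    by (simp add: kernel_odd)
  then have "?I + ?I = 0"
    by (subst (asm) integral_minus) (simp add: eq_neg_iff_add_eq_0)
  then show "?I = 0"
    by (simp add: scaleR_2[symmetric])
qed

end

text \<open>
  Only the size of \<open>t * f t\<close> near \<open>0\<close> matters for high frequencies. Cut the kernel at the radius
  \<open>\<delta>\<close>: the inner profile is still decreasing and satisfies the bound \<open>M\<close> everywhere, so it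
  contributes at most a dimensional constant times \<open>M\<close> for every \<open>k\<close>; the outer part is integrable
  and continuous off a sphere, so its contribution \<open>\<eta>\<close> tends to \<open>0\<close>.
\<close>

lemma (in compact_kernel) norm_symbol_le:
  assumes e: "norm e = 1"
    and anti: "antimono_on {0<..} f"
    and R_eq: "\<And>z. z \<noteq> 0 \<Longrightarrow> R z = f (norm z) * (norm z)\<^sup>2 / norm z ^ DIM('a)"
    and \<delta>: "0 < \<delta>" and le: "\<And>t. 0 < t \<Longrightarrow> t < \<delta> \<Longrightarrow> t * f t \<le> M"
  obtains \<eta> where "\<eta> \<longlonglongrightarrow> (0::real)"
    "\<And>k. norm (symbol (real k *\<^sub>R e)) \<le> 3 / ln 2 * measure lborel {w::'a. 1 \<le> norm w \<and> norm w \<le> 2} * M + \<eta> k"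
proof -
  let ?K = "gradient_kernel R" and ?C = "3 / ln 2 * measure lborel {w::'a. 1 \<le> norm w \<and> norm w \<le> 2}"
  define far where "far z = indicator {z. \<delta> \<le> norm z} z *\<^sub>R ?K z" for z
  \<comment> \<open>The truncated profile \<open>f\<close>, written through \<open>R\<close> because \<open>f\<close> is arbitrary on nonpositive arguments and need not be measurable there.\<close>
  define g where "g t = (if 0 < t \<and> t < \<delta> then R (t *\<^sub>R e) * t ^ DIM('a) / t\<^sup>2 else 0)" for t
  have [measurable]: "g \<in> borel_measurable borel"
    unfolding g_def by measurable
  have [measurable]: "far \<in> borel_measurable borel"
    unfolding far_def by measurable
  have K_eq: "?K z = (f (norm z) / norm z ^ DIM('a)) *\<^sub>R z" if "z \<noteq> 0" for z
    using that by (simp add: gradient_kernel_def R_eq)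
  have f_eq: "f t = R (t *\<^sub>R e) * t ^ DIM('a) / t\<^sup>2" if "0 < t" for t
  proof -
    have "t *\<^sub>R e \<noteq> 0" "norm (t *\<^sub>R e) = t"
      using that e by auto
    then show ?thesis
      using that R_eq[of "t *\<^sub>R e"] by simp
  qed
  have f_nonneg: "0 \<le> f t" if "0 < t" for t
    using that nonneg[of "t *\<^sub>R e"] by (simp add: f_eq)
  have g_eq: "g t = (if t < \<delta> then f t else 0)" if "0 < t" for t
    using that by (simp add: g_def f_eq)
  have M: "0 \<le> M"
    using le[of "\<delta> / 2"] mult_nonneg_nonneg[OF _ f_nonneg, of "\<delta> / 2" "\<delta> / 2"] \<delta> by linarith
  have near_eq: "(g (norm z) / norm z ^ DIM('a)) *\<^sub>R z = ?K z - far z" for z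
  proof (cases "z = 0")
    case True
    then show ?thesis
      by (simp add: far_def gradient_kernel_def)
  next
    case False
    then show ?thesis
      using g_eq[of "norm z"] by (simp add: far_def K_eq indicator_def)
  qed
  have int_far: "integrable lborel far"
  proof -
    have "integrable lborel (\<lambda>z. indicator {z. \<delta> \<le> norm z} z *\<^sub>R ?K z)"
    proof (rule integrable_scaleR_kernel[where L = "1 / \<delta>"])
      show "\<bar>indicator {z. \<delta> \<le> norm z} z\<bar> \<le> 1 / \<delta> * norm z" for z :: 'a
        using \<delta> by (auto simp: indicator_def field_simps)
    qed (use \<delta> in auto)
    then show ?thesis
      by (simp add: far_def[abs_def])
  qed
  have near: "norm (LINT z|lborel. sin (z \<bullet> \<xi>) *\<^sub>R (g (norm z) / norm z ^ DIM('a)) *\<^sub>R z) \<le> ?C * M" for \<xi> :: 'a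
  proof (rule oscillatory_kernel_integral_le[where f = g and T = \<delta>])
    show "antimono_on {0<..} g"
    proof (rule monotone_onI)
      fix s t :: real
      assume "s \<in> {0<..}" "t \<in> {0<..}" "s \<le> t"
      then show "g t \<le> g s"
        using monotone_onD[OF anti, of s t] f_nonneg[of s] by (auto simp: g_eq)
    qed
    show "0 \<le> g t" if "0 < t" for t
      using that f_nonneg by (simp add: g_eq)
    show "t * g t \<le> M" if "0 < t" for t
      using that le M by (simp add: g_eq)
    show "g t = 0" if "\<delta> \<le> t" for t
      using that by (simp add: g_def)
    have "integrable lborel (\<lambda>z. sin (z \<bullet> \<xi>) *\<^sub>R far z)"
    proof (rule Bochner_Integration.integrable_bound[OF int_far])
      show "AE z in lborel. norm (sin (z \<bullet> \<xi>) *\<^sub>R far z) \<le> norm (far z)"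
        by (intro AE_I2) (simp add: mult_left_le_one_le)
    qed measurable
    then show "integrable lborel (\<lambda>z. sin (z \<bullet> \<xi>) *\<^sub>R (g (norm z) / norm z ^ DIM('a)) *\<^sub>R z)"
      unfolding near_eq scaleR_diff_right
      by (intro Bochner_Integration.integrable_diff integrable_sin_kernel)
  qed measurable
  define \<eta> where "\<eta> k = norm (LINT z|lborel. sin (real k * (z \<bullet> e) + 0) *\<^sub>R far z)" for k
  have "\<eta> \<longlonglongrightarrow> 0"
    unfolding \<eta>_def
  proof (intro tendsto_norm_zero riemann_lebesgue int_far e)
    have "AE z in lborel. z \<notin> sphere (0::'a) \<delta>"
    proof (rule AE_not_in)
      have "sphere (0::'a) \<delta> \<in> null_sets lebesgue"
        using negligible_sphere negligible_iff_null_sets by blast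
      then show "sphere (0::'a) \<delta> \<in> null_sets lborel"
        by (simp add: null_sets_completion_iff)
    qed
    then show "AE z in lborel. isCont far z"
      using AE_lborel_singleton[of "0::'a"]
    proof eventually_elim
      case (elim z)
      have K: "isCont ?K z"
        using elim by (intro isCont_gradient_kernel) auto
      consider "norm z < \<delta>" | "\<delta> < norm z"
        using elim by fastforce
      then show ?case
      proof cases
        case 1
        have "\<forall>\<^sub>F y in nhds z. y \<in> ball 0 \<delta>"
          using 1 by (intro eventually_nhds_in_open) auto
        then have "\<forall>\<^sub>F y in nhds z. far y = 0"
          by eventually_elim (auto simp: far_def)
        then show ?thesis
          using isCont_cong[of far "\<lambda>_. 0" z] by simp
      next
        case 2
        have "\<forall>\<^sub>F y in nhds z. y \<in> - cball 0 \<delta>"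
          using 2 by (intro eventually_nhds_in_open) auto
        then have "\<forall>\<^sub>F y in nhds z. far y = ?K y"
          by eventually_elim (auto simp: far_def)
        then show ?thesis
          using isCont_cong[of far ?K z] K by simp
      qed
    qed
  qed
  moreover have "norm (symbol (real k *\<^sub>R e)) \<le> ?C * M + \<eta> k" for k
  proof -
    let ?s = "\<lambda>z. sin (z \<bullet> (real k *\<^sub>R e))"
    have "integrable lborel (\<lambda>z. ?s z *\<^sub>R far z)"
    proof (rule Bochner_Integration.integrable_bound[OF int_far])
      show "AE z in lborel. norm (?s z *\<^sub>R far z) \<le> norm (far z)"
        by (intro AE_I2) (simp add: mult_left_le_one_le)
    qed measurable
    then have "(LINT z|lborel. ?s z *\<^sub>R (g (norm z) / norm z ^ DIM('a)) *\<^sub>R z)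
        = symbol (real k *\<^sub>R e) - (LINT z|lborel. ?s z *\<^sub>R far z)"
      unfolding near_eq symbol_def scaleR_diff_right
      by (intro Bochner_Integration.integral_diff integrable_sin_kernel)
    then have "symbol (real k *\<^sub>R e) = (LINT z|lborel. ?s z *\<^sub>R (g (norm z) / norm z ^ DIM('a)) *\<^sub>R z)
        + (LINT z|lborel. ?s z *\<^sub>R far z)"
      by (simp only: diff_add_cancel)
    moreover have "\<eta> k = norm (LINT z|lborel. ?s z *\<^sub>R far z)"
      by (simp add: \<eta>_def)
    ultimately show ?thesis
      by (simp only: norm_triangle_mono[OF near order_refl])
  qed
  ultimately show thesis
    by (rule that)
qed

context compact_kernel
begin

lemma symbol_tendsto_0:
  assumes "norm e = 1" "antimono_on {0<..} f"
    and "\<And>z. z \<noteq> 0 \<Longrightarrow> R z = f (norm z) * (norm z)\<^sup>2 / norm z ^ DIM('a)"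
    and small: "\<And>M. 0 < M \<Longrightarrow> \<exists>\<delta>>0. \<forall>t\<in>{0<..<\<delta>}. t * f t \<le> M"
  shows "(\<lambda>k. symbol (real k *\<^sub>R e)) \<longlonglongrightarrow> 0"
proof (rule LIMSEQ_I)
  define C where "C = 3 / ln 2 * measure lborel {w::'a. 1 \<le> norm w \<and> norm w \<le> 2}"
  have C: "0 \<le> C"
    by (simp add: C_def)
  fix a :: real
  assume a: "0 < a"
  \<comment> \<open>\<open>C + 1\<close> rather than \<open>C\<close>, as \<open>C\<close> is only known to be nonnegative here.\<close>
  define M where "M = a / (2 * (C + 1))"
  have M: "0 < M" "C * M < a / 2"
    using a C by (auto simp: M_def field_simps intro: add_nonneg_pos)
  obtain \<delta> where "0 < \<delta>" "\<And>t. 0 < t \<Longrightarrow> t < \<delta> \<Longrightarrow> t * f t \<le> M"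
    using small[OF M(1)] by auto
  then obtain \<eta> where \<eta>: "\<eta> \<longlonglongrightarrow> 0" "\<And>k. norm (symbol (real k *\<^sub>R e)) \<le> C * M + \<eta> k"
    unfolding C_def using norm_symbol_le[OF assms(1-3)] by blast
  have "\<forall>\<^sub>F k in sequentially. \<eta> k < a / 2"
    using \<eta>(1) a by (intro order_tendstoD(2)) auto
  then have "\<forall>\<^sub>F k in sequentially. norm (symbol (real k *\<^sub>R e) - 0) < a"
  proof eventually_elim
    case (elim k)
    then show ?case
      using \<eta>(2)[of k] M(2) by simp
  qed
  then show "\<exists>no. \<forall>k\<ge>no. norm (symbol (real k *\<^sub>R e) - 0) < a"
    by (simp add: eventually_sequentially)
qed

lemma symbol_bounded:
  assumes "norm e = 1" "antimono_on {0<..} f"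
    and "\<And>z. z \<noteq> 0 \<Longrightarrow> R z = f (norm z) * (norm z)\<^sup>2 / norm z ^ DIM('a)"
    and "0 < \<delta>" "\<And>t. 0 < t \<Longrightarrow> t < \<delta> \<Longrightarrow> t * f t \<le> M"
  shows "\<exists>B. \<forall>k. norm (symbol (real k *\<^sub>R e)) \<le> B"
proof -
  obtain \<eta> where \<eta>: "\<eta> \<longlonglongrightarrow> 0"
    "\<And>k. norm (symbol (real k *\<^sub>R e)) \<le> 3 / ln 2 * measure lborel {w::'a. 1 \<le> norm w \<and> norm w \<le> 2} * M + \<eta> k"
    using norm_symbol_le[OF assms] by blast
  obtain B where B: "\<And>k. \<bar>\<eta> k\<bar> \<le> B"
    using convergent_imp_Bseq[OF convergentI[OF \<eta>(1)]] by (auto simp: Bseq_def)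
  show ?thesis
  proof (intro exI allI)
    fix k
    show "norm (symbol (real k *\<^sub>R e)) \<le> 3 / ln 2 * measure lborel {w::'a. 1 \<le> norm w \<and> norm w \<le> 2} * M + B"
      using \<eta>(2)[of k] B[of k] by linarith
  qed
qed

end

section \<open>Wave packets in \<open>L\<^sup>2\<close>\<close>

lemma L2_norm_on_lborel:
  assumes "A \<in> sets borel" "u \<in> borel_measurable borel"
  shows "L2_norm_on A u = sqrt (LINT x|lborel. indicator A x *\<^sub>R (norm (u x))\<^sup>2)"
  unfolding L2_norm_on_def set_lebesgue_integral_def using assms by (subst integral_completion) auto

lemma L2_lborelI:
  assumes [measurable]: "u \<in> borel_measurable borel" and "integrable lborel (\<lambda>x. (norm (u x))\<^sup>2)"
  shows "u \<in> L2"
  using assms by (auto simp: L2_def integrable_completion measurable_completion)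

lemma L2_norm_on_nonneg: "0 \<le> L2_norm_on A u"
  unfolding L2_norm_on_def set_lebesgue_integral_def by (intro real_sqrt_ge_zero integral_nonneg) auto

lemma dist_L2_norm_nonneg:
  assumes "L2_representatives T \<noteq> {}"
  shows "0 \<le> dist_L2_norm T"
  unfolding dist_L2_norm_def by (intro cINF_greatest assms L2_norm_on_nonneg)

lemma dist_L2_norm_le:
  assumes "G \<in> L2_representatives T"
  shows "dist_L2_norm T \<le> L2_norm_on UNIV G"
  unfolding dist_L2_norm_def by (intro cINF_lower assms bdd_belowI2[of _ 0] L2_norm_on_nonneg)

definition wave_packet :: "('a::euclidean_space \<Rightarrow> real) \<Rightarrow> 'a \<Rightarrow> nat \<Rightarrow> 'a \<Rightarrow> real" where
  "wave_packet \<phi> e k x = \<phi> x * cos (real k * (x \<bullet> e))"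

locale envelope =
  fixes \<phi> :: "'a::euclidean_space \<Rightarrow> real" and e :: 'a and L r :: real
  assumes lipschitz: "L-lipschitz_on UNIV \<phi>"
    and vanish: "r < norm x \<Longrightarrow> \<phi> x = 0"
    and unit: "norm e = 1"
begin

lemma continuous: "continuous_on UNIV \<phi>"
  using lipschitz by (rule lipschitz_on_continuous_on)

lemma borel_envelope [measurable]: "\<phi> \<in> borel_measurable borel"
  using continuous by (rule borel_measurable_continuous_onI)

lemma bounded_envelope: obtains B where "0 \<le> B" "\<And>x. \<bar>\<phi> x\<bar> \<le> B"
proof -
  have "compact (\<phi> ` cball 0 r)"
    using continuous by (intro compact_continuous_image) (auto intro: continuous_on_subset)
  then obtain B where "B > 0" "\<And>y. y \<in> \<phi> ` cball 0 r \<Longrightarrow> norm y \<le> B"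
    using compact_imp_bounded bounded_pos by metis
  then have "\<bar>\<phi> x\<bar> \<le> B" for x
    using vanish[of x] by (cases "r < norm x") auto
  then show thesis
    using that \<open>B > 0\<close> by (meson less_imp_le)
qed

lemma wave_packet_continuous: "continuous_on UNIV (wave_packet \<phi> e k)"
  unfolding wave_packet_def by (intro continuous_intros continuous)

lemma wave_packet_vanish: "r < norm x \<Longrightarrow> wave_packet \<phi> e k x = 0"
  by (simp add: wave_packet_def vanish)

lemma wave_packet_lipschitz: "\<exists>L'. L'-lipschitz_on UNIV (wave_packet \<phi> e k)"
proof -
  obtain B where B: "0 \<le> B" "\<And>x. \<bar>\<phi> x\<bar> \<le> B"
    using bounded_envelope by blast
  have "\<bar>wave_packet \<phi> e k x - wave_packet \<phi> e k y\<bar> \<le> (L + B * real k) * norm (x - y)" for x y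
  proof -
    have "\<bar>cos (real k * (x \<bullet> e)) - cos (real k * (y \<bullet> e))\<bar> \<le> real k * norm (x - y)"
    proof -
      have "\<bar>(x - y) \<bullet> e\<bar> \<le> norm (x - y)"
        using Cauchy_Schwarz_ineq2[of "x - y" e] unit by simp
      then have "\<bar>real k * (x \<bullet> e) - real k * (y \<bullet> e)\<bar> \<le> real k * norm (x - y)"
        by (simp add: right_diff_distrib[symmetric] inner_diff_left[symmetric] abs_mult mult_left_mono)
      then show ?thesis
        by (rule order_trans[OF abs_cos_diff_le])
    qed
    then have "\<bar>\<phi> x\<bar> * \<bar>cos (real k * (x \<bullet> e)) - cos (real k * (y \<bullet> e))\<bar> \<le> B * (real k * norm (x - y))"
      using B by (intro mult_mono) auto
    moreover have "\<bar>\<phi> x - \<phi> y\<bar> * \<bar>cos (real k * (y \<bullet> e))\<bar> \<le> L * norm (x - y) * 1"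
      using lipschitz_onD[OF lipschitz, of x y] lipschitz_on_nonneg[OF lipschitz]
      by (intro mult_mono) (auto simp: dist_norm)
    moreover have "wave_packet \<phi> e k x - wave_packet \<phi> e k y = \<phi> x * (cos (real k * (x \<bullet> e)) - cos (real k * (y \<bullet> e)))
        + (\<phi> x - \<phi> y) * cos (real k * (y \<bullet> e))"
      by (simp add: wave_packet_def algebra_simps)
    ultimately show ?thesis
      using abs_triangle_ineq[of "\<phi> x * (cos (real k * (x \<bullet> e)) - cos (real k * (y \<bullet> e)))" "(\<phi> x - \<phi> y) * cos (real k * (y \<bullet> e))"]
      unfolding abs_mult distrib_right by (simp only: mult_1_right mult.assoc)
  qed
  then have "(L + B * real k)-lipschitz_on UNIV (wave_packet \<phi> e k)"
    using B lipschitz_on_nonneg[OF lipschitz] by (intro lipschitz_onI) (auto simp: dist_norm)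
  then show ?thesis ..
qed

lemma integral_wave_packet_mult_tendsto:
  assumes "continuous_on UNIV g"
  shows "(\<lambda>k. LINT x|lborel. wave_packet \<phi> e k x * g x) \<longlonglongrightarrow> 0"
proof -
  have "integrable lborel (\<lambda>x. \<phi> x * g x)"
    using continuous assms vanish by (intro continuous_compact_support_integrable[where r = r] continuous_intros) auto
  moreover have "continuous_on UNIV (\<lambda>x. \<phi> x * g x)"
    using continuous assms by (intro continuous_intros)
  then have "AE x in lborel. isCont (\<lambda>x. \<phi> x * g x) x"
    by (intro AE_I2) (simp add: continuous_on_eq_continuous_at)
  ultimately have "(\<lambda>k. LINT x|lborel. sin (real k * (x \<bullet> e) + pi / 2) *\<^sub>R (\<phi> x * g x)) \<longlonglongrightarrow> 0"
    using unit by (rule riemann_lebesgue)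
  then show ?thesis
    by (simp add: sin_cos_eq[symmetric] wave_packet_def sin_add ac_simps)
qed

lemma integral_wave_packet_square_tendsto:
  "(\<lambda>k. LINT x|lborel. (wave_packet \<phi> e k x)\<^sup>2) \<longlonglongrightarrow> (LINT x|lborel. (\<phi> x)\<^sup>2) / 2"
proof -
  have int: "integrable lborel (\<lambda>x. \<phi> x * \<phi> x * c x)" if "continuous_on UNIV c" for c
    using continuous that vanish by (intro continuous_compact_support_integrable[where r = r] continuous_intros) auto
  have "(LINT x|lborel. (wave_packet \<phi> e k x)\<^sup>2)
      = (LINT x|lborel. (\<phi> x)\<^sup>2) / 2 + (LINT x|lborel. wave_packet \<phi> e (2 * k) x * \<phi> x) / 2" for k
  proof -
    have "(wave_packet \<phi> e k x)\<^sup>2 = \<phi> x * \<phi> x * (1 / 2) + \<phi> x * \<phi> x * (cos (real (2 * k) * (x \<bullet> e)) / 2)" for x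
    proof -
      have "(cos (real k * (x \<bullet> e)))\<^sup>2 = 1 / 2 + cos (real (2 * k) * (x \<bullet> e)) / 2"
        using cos_double_cos[of "real k * (x \<bullet> e)"] by (simp add: mult.assoc diff_divide_distrib)
      then show ?thesis
        unfolding wave_packet_def power_mult_distrib by (simp add: power2_eq_square algebra_simps)
    qed
    then have "(LINT x|lborel. (wave_packet \<phi> e k x)\<^sup>2)
        = (LINT x|lborel. \<phi> x * \<phi> x * (1 / 2)) + (LINT x|lborel. \<phi> x * \<phi> x * (cos (real (2 * k) * (x \<bullet> e)) / 2))"
      by (simp only:) (intro Bochner_Integration.integral_add int continuous_intros; simp)
    then show ?thesis
      by (simp add: wave_packet_def power2_eq_square ac_simps)
  qed
  moreover have "(\<lambda>k. LINT x|lborel. wave_packet \<phi> e (2 * k) x * \<phi> x) \<longlonglongrightarrow> 0"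
    using LIMSEQ_subseq_LIMSEQ[OF integral_wave_packet_mult_tendsto[OF continuous], of "\<lambda>k. 2 * k"]
    by (simp add: strict_mono_def o_def)
  then have "(\<lambda>k. (LINT x|lborel. (\<phi> x)\<^sup>2) / 2 + (LINT x|lborel. wave_packet \<phi> e (2 * k) x * \<phi> x) / 2)
      \<longlonglongrightarrow> (LINT x|lborel. (\<phi> x)\<^sup>2) / 2 + 0 / 2"
    by (intro tendsto_intros) auto
  ultimately show ?thesis
    by simp
qed

text \<open>
  Packets of very different frequencies are almost orthogonal, so their distance does not become
  small; this is what destroys compactness.
\<close>

lemma integral_wave_packet_diff_square_tendsto:
  "(\<lambda>k. LINT x|lborel. (wave_packet \<phi> e k x - wave_packet \<phi> e j x)\<^sup>2)
    \<longlonglongrightarrow> (LINT x|lborel. (\<phi> x)\<^sup>2) / 2 + (LINT x|lborel. (wave_packet \<phi> e j x)\<^sup>2)"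
proof -
  have int: "integrable lborel (\<lambda>x. wave_packet \<phi> e k x * wave_packet \<phi> e l x)" for k l
    using wave_packet_continuous wave_packet_vanish
    by (intro continuous_compact_support_integrable[where r = r] continuous_intros) auto
  have "(LINT x|lborel. (wave_packet \<phi> e k x - wave_packet \<phi> e j x)\<^sup>2)
      = (LINT x|lborel. (wave_packet \<phi> e k x)\<^sup>2) - 2 * (LINT x|lborel. wave_packet \<phi> e k x * wave_packet \<phi> e j x)
        + (LINT x|lborel. (wave_packet \<phi> e j x)\<^sup>2)" for k
  proof -
    have "(wave_packet \<phi> e k x - wave_packet \<phi> e j x)\<^sup>2 = wave_packet \<phi> e k x * wave_packet \<phi> e k x
        - 2 * (wave_packet \<phi> e k x * wave_packet \<phi> e j x) + wave_packet \<phi> e j x * wave_packet \<phi> e j x" for x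
      by (simp add: power2_eq_square algebra_simps)
    then show ?thesis
      using int[of k k] int[of k j] int[of j j] by (simp add: power2_eq_square)
  qed
  moreover have "(\<lambda>k. (LINT x|lborel. (wave_packet \<phi> e k x)\<^sup>2)
        - 2 * (LINT x|lborel. wave_packet \<phi> e k x * wave_packet \<phi> e j x) + (LINT x|lborel. (wave_packet \<phi> e j x)\<^sup>2))
      \<longlonglongrightarrow> (LINT x|lborel. (\<phi> x)\<^sup>2) / 2 - 2 * 0 + (LINT x|lborel. (wave_packet \<phi> e j x)\<^sup>2)"
    by (intro tendsto_intros integral_wave_packet_square_tendsto
        integral_wave_packet_mult_tendsto wave_packet_continuous)
  ultimately show ?thesis
    by simp
qed

lemma borel_wave_packet [measurable]: "wave_packet \<phi> e k \<in> borel_measurable borel"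
  using wave_packet_continuous by (rule borel_measurable_continuous_onI)

lemma integrable_wave_packet_square: "integrable lborel (\<lambda>x. (norm (wave_packet \<phi> e k x))\<^sup>2)"
  using wave_packet_vanish
  by (intro continuous_compact_support_integrable[where r = r] continuous_intros wave_packet_continuous) auto

lemma wave_packet_L2: "wave_packet \<phi> e k \<in> L2"
  by (intro L2_lborelI integrable_wave_packet_square) measurable

lemma L2_norm_wave_packet_tendsto:
  assumes "\<And>x. x \<notin> \<Omega> \<Longrightarrow> \<phi> x = 0" "\<Omega> \<in> sets borel"
  shows "(\<lambda>k. L2_norm_on \<Omega> (wave_packet \<phi> e k)) \<longlonglongrightarrow> sqrt ((LINT x|lborel. (\<phi> x)\<^sup>2) / 2)"
proof -
  have "L2_norm_on \<Omega> (wave_packet \<phi> e k) = sqrt (LINT x|lborel. (wave_packet \<phi> e k x)\<^sup>2)" for k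
  proof -
    have "indicator \<Omega> x *\<^sub>R (norm (wave_packet \<phi> e k x))\<^sup>2 = (wave_packet \<phi> e k x)\<^sup>2" for x
      using assms(1)[of x] by (cases "x \<in> \<Omega>") (simp_all add: wave_packet_def)
    then show ?thesis
      by (subst L2_norm_on_lborel[OF assms(2)]) (simp_all only: borel_wave_packet)
  qed
  then show ?thesis
    using tendsto_real_sqrt[OF integral_wave_packet_square_tendsto] by simp
qed

text \<open>
  A limit \<open>v\<close> would force all late members of the subsequence to be close to each other. Fixing one
  of them and letting the frequency of the other tend to infinity contradicts almost orthogonality.
\<close>

lemma wave_packet_no_convergent_subseq:
  assumes pos: "0 < (LINT x|lborel. (\<phi> x)\<^sup>2)"
    and n: "strict_mono n" and v: "v \<in> L2"
  shows "\<not> (\<lambda>k. L2_norm_on UNIV (\<lambda>x. wave_packet \<phi> e (n k) x - v x)) \<longlonglongrightarrow> 0"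
proof
  let ?u = "wave_packet \<phi> e"
  define I where "I = (LINT x|lborel. (\<phi> x)\<^sup>2)"
  define d where "d k = (LINT x|lebesgue. (?u k x - v x)\<^sup>2)" for k
  have [measurable]: "v \<in> borel_measurable lebesgue" and v2: "integrable lebesgue (\<lambda>x. (v x)\<^sup>2)"
    using v by (auto simp: L2_def)
  have [measurable]: "?u k \<in> borel_measurable lebesgue" and u2: "integrable lebesgue (\<lambda>x. (?u k x)\<^sup>2)" for k
    using wave_packet_L2[of k] by (auto simp: L2_def)
  have int_d: "integrable lebesgue (\<lambda>x. (?u k x - v x)\<^sup>2)" for k
  proof (rule Bochner_Integration.integrable_bound)
    show "integrable lebesgue (\<lambda>x. 2 * (?u k x)\<^sup>2 + 2 * (v x)\<^sup>2)"
      using u2 v2 by simp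
    show "AE x in lebesgue. norm ((?u k x - v x)\<^sup>2) \<le> norm (2 * (?u k x)\<^sup>2 + 2 * (v x)\<^sup>2)"
    proof (rule AE_I2)
      fix x
      show "norm ((?u k x - v x)\<^sup>2) \<le> norm (2 * (?u k x)\<^sup>2 + 2 * (v x)\<^sup>2)"
        using zero_le_power2[of "?u k x + v x"] abs_ge_self[of "2 * (?u k x)\<^sup>2 + 2 * (v x)\<^sup>2"]
        unfolding real_norm_def abs_power2 unfolding power2_sum power2_diff by linarith
    qed
  qed measurable
  assume "(\<lambda>k. L2_norm_on UNIV (\<lambda>x. ?u (n k) x - v x)) \<longlonglongrightarrow> 0"
  then have "(\<lambda>k. (L2_norm_on UNIV (\<lambda>x. ?u (n k) x - v x))\<^sup>2) \<longlonglongrightarrow> 0"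
    using tendsto_power[of _ "0::real" sequentially 2] by fastforce
  moreover have "(L2_norm_on UNIV (\<lambda>x. ?u (n k) x - v x))\<^sup>2 = d (n k)" for k
    by (simp add: L2_norm_on_def d_def set_lebesgue_integral_def)
  ultimately have "(\<lambda>k. d (n k)) \<longlonglongrightarrow> 0"
    by simp
  \<comment> \<open>Two members at squared distance below \<open>I / 16\<close> from \<open>v\<close> are at squared distance at most \<open>I / 4\<close> from each other, less than the limit \<open>I / 2\<close> permits.\<close>
  then have "\<forall>\<^sub>F k in sequentially. d (n k) < I / 16"
    using pos by (intro order_tendstoD(2)) (auto simp: I_def)
  then obtain K where K: "\<And>k. K \<le> k \<Longrightarrow> d (n k) < I / 16"
    by (auto simp: eventually_sequentially)
  have "(LINT x|lborel. (?u (n k) x - ?u (n K) x)\<^sup>2) \<le> I / 4" if "K \<le> k" for k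
  proof -
    have "(LINT x|lborel. (?u (n k) x - ?u (n K) x)\<^sup>2) = (LINT x|lebesgue. (?u (n k) x - ?u (n K) x)\<^sup>2)"
      by (rule integral_completion[symmetric]) measurable
    also have "\<dots> \<le> (LINT x|lebesgue. 2 * (?u (n k) x - v x)\<^sup>2 + 2 * (?u (n K) x - v x)\<^sup>2)"
    proof (rule integral_mono')
      show "integrable lebesgue (\<lambda>x. 2 * (?u (n k) x - v x)\<^sup>2 + 2 * (?u (n K) x - v x)\<^sup>2)"
        using int_d by simp
      show "(?u (n k) x - ?u (n K) x)\<^sup>2 \<le> 2 * (?u (n k) x - v x)\<^sup>2 + 2 * (?u (n K) x - v x)\<^sup>2" for x
      proof -
        have "(a - b)\<^sup>2 \<le> 2 * (a - c)\<^sup>2 + 2 * (b - c)\<^sup>2" for a b c :: real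
          using zero_le_power2[of "a + b - 2 * c"] by (simp add: power2_eq_square algebra_simps)
        then show ?thesis .
      qed
    qed auto
    also have "\<dots> = 2 * d (n k) + 2 * d (n K)"
      using int_d by (simp add: d_def)
    finally show ?thesis
      using K[OF that] K[of K] by simp
  qed
  moreover have "(\<lambda>k. LINT x|lborel. (?u (n k) x - ?u (n K) x)\<^sup>2)
      \<longlonglongrightarrow> I / 2 + (LINT x|lborel. (?u (n K) x)\<^sup>2)"
    using LIMSEQ_subseq_LIMSEQ[OF integral_wave_packet_diff_square_tendsto[of "n K"] n]
    by (simp add: o_def I_def)
  ultimately have "I / 2 + (LINT x|lborel. (?u (n K) x)\<^sup>2) \<le> I / 4"
    by (intro LIMSEQ_le_const2) auto
  moreover have "0 \<le> (LINT x|lborel. (?u (n K) x)\<^sup>2)"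
    by simp
  ultimately show False
    using pos by (simp add: I_def)
qed

end

lemma cone_envelope:
  fixes \<Omega> :: "'a::euclidean_space set"
  assumes "\<Omega> \<noteq> {}" "open \<Omega>" "norm e = 1"
  obtains \<phi> r where "envelope \<phi> e 1 r" "\<And>x. x \<notin> \<Omega> \<Longrightarrow> \<phi> x = 0" "0 < (LINT x|lborel. (\<phi> x)\<^sup>2)"
proof -
  obtain x0 s where s: "0 < s" "ball x0 s \<subseteq> \<Omega>"
    using assms(1,2) open_contains_ball by blast
  define \<phi> where "\<phi> x = max 0 (s - dist x0 x)" for x
  have outside: "\<phi> x = 0" if "x \<notin> ball x0 s" for x
    using that by (simp add: \<phi>_def)
  have env: "envelope \<phi> e 1 (norm x0 + s)"
  proof
    show "1-lipschitz_on UNIV \<phi>"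
    proof (rule lipschitz_onI)
      fix x y
      have "\<bar>dist x0 x - dist x0 y\<bar> \<le> dist x y"
        by (metis abs_dist_diff_le dist_commute)
      then show "dist (\<phi> x) (\<phi> y) \<le> 1 * dist x y"
        unfolding \<phi>_def dist_real_def by linarith
    qed simp
    show "\<phi> x = 0" if "norm x0 + s < norm x" for x
      using that norm_triangle_sub[of x x0] by (intro outside) (auto simp: dist_norm norm_minus_commute)
  qed fact
  interpret envelope \<phi> e 1 "norm x0 + s"
    by (rule env)
  have "0 < (s / 2)\<^sup>2 * measure lborel (ball x0 (s / 2))"
    using s(1) content_ball_pos[of "s / 2" x0] by simp
  also have "\<dots> = (LINT x|lborel. indicator (ball x0 (s / 2)) x * (s / 2)\<^sup>2)"
    using emeasure_lborel_ball_finite[of x0 "s / 2"] by simp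
  also have "\<dots> \<le> (LINT x|lborel. (\<phi> x)\<^sup>2)"
  proof (rule integral_mono')
    show "integrable lborel (\<lambda>x. (\<phi> x)\<^sup>2)"
      using vanish
      by (intro continuous_compact_support_integrable[where r = "norm x0 + s"] continuous_intros continuous) auto
    show "indicator (ball x0 (s / 2)) x * (s / 2)\<^sup>2 \<le> (\<phi> x)\<^sup>2" for x
    proof (cases "x \<in> ball x0 (s / 2)")
      case True
      then have "s / 2 \<le> \<phi> x"
        by (simp add: \<phi>_def le_max_iff_disj)
      then show ?thesis
        using True s(1) power_mono[of "s / 2" "\<phi> x" 2] by simp
    qed simp
  qed simp
  finally show thesis
    using that env outside s(2) by blast
qed

section \<open>Nonlocal gradients of wave packets\<close>

locale wave_packet_gradient = compact_kernel R S + envelope \<phi> e L r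
  for R :: "'a::euclidean_space \<Rightarrow> real" and S :: real
    and \<phi> :: "'a \<Rightarrow> real" and e :: 'a and L r :: real
begin

text \<open>
  What is left of the gradient of a packet after freezing the envelope at \<open>x\<close>. The kernel only meets
  differences of the envelope here, so the integrand is dominated by \<open>L * R z\<close> for all frequencies.
\<close>

definition remainder :: "nat \<Rightarrow> 'a \<Rightarrow> 'a" where
  "remainder k x = (LINT z|lborel. ((\<phi> x - \<phi> (x - z)) * cos (real k * ((x - z) \<bullet> e))) *\<^sub>R gradient_kernel R z)"

lemma envelope_diff_le: "\<bar>\<phi> x - \<phi> (x - z)\<bar> \<le> L * norm z"
  using lipschitz_onD[OF lipschitz, of x "x - z"] by (simp add: dist_norm)

lemma L_nonneg: "0 \<le> L"
  using lipschitz by (rule lipschitz_on_nonneg)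

lemma envelope_diff_cos_le: "\<bar>(\<phi> x - \<phi> (x - z)) * cos (real k * ((x - z) \<bullet> e))\<bar> \<le> L * norm z"
proof -
  have "\<bar>\<phi> x - \<phi> (x - z)\<bar> * \<bar>cos (real k * ((x - z) \<bullet> e))\<bar> \<le> L * norm z * 1"
    using L_nonneg by (intro mult_mono envelope_diff_le) auto
  then show ?thesis
    by (simp add: abs_mult)
qed

lemma integrable_remainder:
  "integrable lborel (\<lambda>z. ((\<phi> x - \<phi> (x - z)) * cos (real k * ((x - z) \<bullet> e))) *\<^sub>R gradient_kernel R z)"
  by (rule integrable_scaleR_kernel[OF _ envelope_diff_cos_le L_nonneg]) measurable

text \<open>
  With the envelope frozen at \<open>x\<close>, the addition theorem splits the difference of cosines into a part
  odd in \<open>z\<close>, which produces the symbol, and a part even in \<open>z\<close>, which cancels against the odd kernel.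
\<close>

lemma nonlocal_grad_wave_packet:
  "nonlocal_grad R (wave_packet \<phi> e k) x
    = remainder k x - (\<phi> x * sin (real k * (x \<bullet> e))) *\<^sub>R symbol (real k *\<^sub>R e)"
proof -
  let ?K = "gradient_kernel R" and ?\<xi> = "real k *\<^sub>R e"
  have "(wave_packet \<phi> e k x - wave_packet \<phi> e k (x - z)) *\<^sub>R ?K z
    = ((\<phi> x - \<phi> (x - z)) * cos (real k * ((x - z) \<bullet> e))) *\<^sub>R ?K z
      + (\<phi> x * cos (real k * (x \<bullet> e))) *\<^sub>R ((1 - cos (z \<bullet> ?\<xi>)) *\<^sub>R ?K z)
      - (\<phi> x * sin (real k * (x \<bullet> e))) *\<^sub>R (sin (z \<bullet> ?\<xi>) *\<^sub>R ?K z)" for z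
  proof -
    have "wave_packet \<phi> e k x - wave_packet \<phi> e k (x - z)
      = (\<phi> x - \<phi> (x - z)) * cos (real k * ((x - z) \<bullet> e))
        + \<phi> x * cos (real k * (x \<bullet> e)) * (1 - cos (z \<bullet> ?\<xi>))
        - \<phi> x * sin (real k * (x \<bullet> e)) * sin (z \<bullet> ?\<xi>)"
      by (simp add: wave_packet_def inner_diff_left right_diff_distrib cos_diff) (simp add: algebra_simps)
    moreover have "(a + b * p - c * q) *\<^sub>R v = a *\<^sub>R v + b *\<^sub>R (p *\<^sub>R v) - c *\<^sub>R (q *\<^sub>R v)" for a b c p q and v :: 'a
      by (simp add: scaleR_add_left scaleR_diff_left)
    ultimately show ?thesis
      by (simp only:)
  qed
  then have "nonlocal_grad R (wave_packet \<phi> e k) x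
    = (LINT z|lborel. ((\<phi> x - \<phi> (x - z)) * cos (real k * ((x - z) \<bullet> e))) *\<^sub>R ?K z
      + (\<phi> x * cos (real k * (x \<bullet> e))) *\<^sub>R ((1 - cos (z \<bullet> ?\<xi>)) *\<^sub>R ?K z)
      - (\<phi> x * sin (real k * (x \<bullet> e))) *\<^sub>R (sin (z \<bullet> ?\<xi>) *\<^sub>R ?K z))"
    unfolding nonlocal_grad_def by simp
  also have "\<dots> = remainder k x
      + (\<phi> x * cos (real k * (x \<bullet> e))) *\<^sub>R (LINT z|lborel. (1 - cos (z \<bullet> ?\<xi>)) *\<^sub>R ?K z)
      - (\<phi> x * sin (real k * (x \<bullet> e))) *\<^sub>R (LINT z|lborel. sin (z \<bullet> ?\<xi>) *\<^sub>R ?K z)"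
    unfolding remainder_def
    by (intro has_bochner_integral_integral_eq has_bochner_integral_diff has_bochner_integral_add
        has_bochner_integral_scaleR_right has_bochner_integral_integrable
        integrable_remainder integral_one_minus_cos_kernel(1) integrable_sin_kernel)
  finally show ?thesis
    by (simp only: integral_one_minus_cos_kernel(2) symbol_def scaleR_zero_right add_0_right)
qed

lemma borel_remainder [measurable]: "remainder k \<in> borel_measurable borel"
  unfolding remainder_def by measurable

lemma norm_remainder_le: "norm (remainder k x) \<le> L * (LINT z|lborel. R z)"
proof -
  have "norm (remainder k x) \<le> (LINT z|lborel. L * R z)"
    unfolding remainder_def
  proof (rule Bochner_Integration.integral_norm_bound_integral[OF integrable_remainder])
    show "integrable lborel (\<lambda>z. L * R z)"
      using integrable by simp
  qed (rule scaleR_kernel_le[OF envelope_diff_cos_le L_nonneg])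
  then show ?thesis
    by simp
qed

text \<open>
  A negative \<open>S\<close> is possible, for the zero kernel, and then \<open>r + S < norm x\<close> alone would not put \<open>x\<close>
  outside the support of the envelope.
\<close>

lemma remainder_vanish:
  assumes "r + S < norm x" "r < norm x"
  shows "remainder k x = 0"
proof -
  have "((\<phi> x - \<phi> (x - z)) * cos (real k * ((x - z) \<bullet> e))) *\<^sub>R gradient_kernel R z = 0" for z
  proof (cases "S < norm z")
    case True
    then show ?thesis
      by (simp add: gradient_kernel_def kernel_vanish)
  next
    case False
    then have "r < norm (x - z)"
      using assms(1) norm_triangle_ineq2[of x z] by linarith
    then show ?thesis
      using assms(2) by (simp add: vanish)
  qed
  then show ?thesis
    by (simp only: remainder_def Bochner_Integration.integral_zero)
qed

text \<open>
  Here it matters that the Riemann-Lebesgue lemma allows arbitrary phases: the cosine oscillates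
  around \<open>x\<close>, not around the origin.
\<close>

lemma remainder_tendsto: "(\<lambda>k. remainder k x) \<longlonglongrightarrow> 0"
proof -
  have int: "integrable lborel (\<lambda>z. (\<phi> x - \<phi> (x - z)) *\<^sub>R gradient_kernel R z)"
    by (rule integrable_scaleR_kernel[OF _ envelope_diff_le L_nonneg]) measurable
  have "isCont (\<lambda>z. (\<phi> x - \<phi> (x - z)) *\<^sub>R gradient_kernel R z) z" if "z \<noteq> 0" for z
  proof -
    have "isCont \<phi> y" for y
      using continuous by (simp add: continuous_on_eq_continuous_at)
    then have "isCont (\<lambda>z. \<phi> (x - z)) z"
      by (intro isCont_o2[where f = "\<lambda>z. x - z" and g = \<phi>] continuous_diff continuous_const continuous_ident)
    then show ?thesis
      by (intro continuous_scaleR continuous_diff continuous_const isCont_gradient_kernel that)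
  qed
  then have "AE z in lborel. isCont (\<lambda>z. (\<phi> x - \<phi> (x - z)) *\<^sub>R gradient_kernel R z) z"
    using AE_lborel_singleton[of "0::'a"] by (auto elim: eventually_mono)
  from riemann_lebesgue[OF int this unit, of "\<lambda>k. pi / 2 - real k * (x \<bullet> e)"]
  have lim: "(\<lambda>k. LINT z|lborel. sin (real k * (z \<bullet> e) + (pi / 2 - real k * (x \<bullet> e))) *\<^sub>R
      (\<phi> x - \<phi> (x - z)) *\<^sub>R gradient_kernel R z) \<longlonglongrightarrow> 0" .
  have "sin (real k * (z \<bullet> e) + (pi / 2 - real k * (x \<bullet> e))) = cos (real k * ((x - z) \<bullet> e))" for k z
    using sin_cos_eq[of "real k * (z \<bullet> e) + (pi / 2 - real k * (x \<bullet> e))"]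
    by (simp add: inner_diff_left right_diff_distrib)
  then show ?thesis
    using lim by (simp add: remainder_def mult.commute)
qed

lemma remainder_square_tendsto: "(\<lambda>k. LINT x|lborel. (norm (remainder k x))\<^sup>2) \<longlonglongrightarrow> 0"
  and integrable_remainder_square: "integrable lborel (\<lambda>x. (norm (remainder k x))\<^sup>2)"
proof -
  define B where "B = cball (0::'a) (max r (r + S))"
  define w where "w x = indicator B x * (L * (LINT z|lborel. R z))\<^sup>2" for x
  have w: "integrable lborel w"
    unfolding w_def B_def using emeasure_lborel_cball_finite[of "0::'a" "max r (r + S)"]
    by (intro integrable_mult_left integrable_real_indicator) auto
  have le: "norm ((norm (remainder k x))\<^sup>2) \<le> w x" for k x
  proof (cases "x \<in> B")
    case True
    have "(norm (remainder k x))\<^sup>2 \<le> (L * (LINT z|lborel. R z))\<^sup>2"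
      by (intro power_mono norm_remainder_le) auto
    then show ?thesis
      using True by (simp add: w_def)
  next
    case False
    then show ?thesis
      using remainder_vanish[of x k] by (simp add: B_def w_def)
  qed
  have lim: "(\<lambda>k. (norm (remainder k x))\<^sup>2) \<longlonglongrightarrow> 0" for x
    using tendsto_power[OF tendsto_norm[OF remainder_tendsto], of x 2] by simp
  have "(\<lambda>k. LINT x|lborel. (norm (remainder k x))\<^sup>2) \<longlonglongrightarrow> (LINT x|(lborel :: 'a measure). (0::real))"
    by (intro integral_dominated_convergence[where w = w] AE_I2 lim le w) measurable
  then show "(\<lambda>k. LINT x|lborel. (norm (remainder k x))\<^sup>2) \<longlonglongrightarrow> 0"
    by simp
  show "integrable lborel (\<lambda>x. (norm (remainder k x))\<^sup>2)"
  proof (rule Bochner_Integration.integrable_bound[OF w])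
    show "AE x in lborel. norm ((norm (remainder k x))\<^sup>2) \<le> norm (w x)"
    proof (rule AE_I2)
      fix x
      show "norm ((norm (remainder k x))\<^sup>2) \<le> norm (w x)"
        using le[of k x] abs_ge_self[of "w x"] by (simp only: real_norm_def)
    qed
  qed measurable
qed

lemma borel_nonlocal_grad [measurable]: "nonlocal_grad R (wave_packet \<phi> e k) \<in> borel_measurable borel"
proof -
  have "nonlocal_grad R (wave_packet \<phi> e k)
      = (\<lambda>x. remainder k x - (\<phi> x * sin (real k * (x \<bullet> e))) *\<^sub>R symbol (real k *\<^sub>R e))"
    by (rule ext) (rule nonlocal_grad_wave_packet)
  moreover have "\<dots> \<in> borel_measurable borel"
    by measurable
  ultimately show ?thesis
    by (simp only:)
qed

lemma nonlocal_grad_square_integral: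
  shows "integrable lborel (\<lambda>x. (norm (nonlocal_grad R (wave_packet \<phi> e k) x))\<^sup>2)"
    and "(LINT x|lborel. (norm (nonlocal_grad R (wave_packet \<phi> e k) x))\<^sup>2)
      \<le> 2 * (norm (symbol (real k *\<^sub>R e)))\<^sup>2 * (LINT x|lborel. (\<phi> x)\<^sup>2)
        + 2 * (LINT x|lborel. (norm (remainder k x))\<^sup>2)"
proof -
  let ?m = "symbol (real k *\<^sub>R e)"
  define w where "w x = 2 * (norm ?m)\<^sup>2 * (\<phi> x)\<^sup>2 + 2 * (norm (remainder k x))\<^sup>2" for x
  have int: "integrable lborel (\<lambda>x. (\<phi> x)\<^sup>2)"
    using vanish by (intro continuous_compact_support_integrable[where r = r] continuous_intros continuous) auto
  have w: "integrable lborel w"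
    unfolding w_def using int integrable_remainder_square by (intro Bochner_Integration.integrable_add integrable_mult_right) auto
  have le: "(norm (nonlocal_grad R (wave_packet \<phi> e k) x))\<^sup>2 \<le> w x" for x
  proof -
    have "norm ((\<phi> x * sin (real k * (x \<bullet> e))) *\<^sub>R ?m) \<le> \<bar>\<phi> x\<bar> * norm ?m"
      using mult_left_le[of "\<bar>sin (real k * (x \<bullet> e))\<bar>" "\<bar>\<phi> x\<bar>"]
      by (auto simp: abs_mult intro!: mult_right_mono)
    then have "norm (nonlocal_grad R (wave_packet \<phi> e k) x) \<le> norm (remainder k x) + \<bar>\<phi> x\<bar> * norm ?m"
      using norm_triangle_ineq4[of "remainder k x" "(\<phi> x * sin (real k * (x \<bullet> e))) *\<^sub>R ?m"]
      unfolding nonlocal_grad_wave_packet by linarith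
    then have "(norm (nonlocal_grad R (wave_packet \<phi> e k) x))\<^sup>2 \<le> (norm (remainder k x) + \<bar>\<phi> x\<bar> * norm ?m)\<^sup>2"
      by (intro power_mono) auto
    also have "\<dots> \<le> 2 * (norm (remainder k x))\<^sup>2 + 2 * (\<bar>\<phi> x\<bar> * norm ?m)\<^sup>2"
      using sum_squares_bound[of "norm (remainder k x)" "\<bar>\<phi> x\<bar> * norm ?m"] unfolding power2_sum by linarith
    finally show ?thesis
      by (simp add: w_def power_mult_distrib mult.commute)
  qed
  show int_grad: "integrable lborel (\<lambda>x. (norm (nonlocal_grad R (wave_packet \<phi> e k) x))\<^sup>2)"
  proof (rule Bochner_Integration.integrable_bound[OF w])
    show "AE x in lborel. norm ((norm (nonlocal_grad R (wave_packet \<phi> e k) x))\<^sup>2) \<le> norm (w x)"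
    proof (rule AE_I2)
      fix x
      show "norm ((norm (nonlocal_grad R (wave_packet \<phi> e k) x))\<^sup>2) \<le> norm (w x)"
        using le[of x] abs_ge_self[of "w x"] by (simp only: real_norm_def abs_power2)
    qed
  qed measurable
  have "(LINT x|lborel. (norm (nonlocal_grad R (wave_packet \<phi> e k) x))\<^sup>2) \<le> (LINT x|lborel. w x)"
    by (intro integral_mono int_grad w le)
  also have "\<dots> = 2 * (norm ?m)\<^sup>2 * (LINT x|lborel. (\<phi> x)\<^sup>2) + 2 * (LINT x|lborel. (norm (remainder k x))\<^sup>2)"
    unfolding w_def using int integrable_remainder_square by simp
  finally show "(LINT x|lborel. (norm (nonlocal_grad R (wave_packet \<phi> e k) x))\<^sup>2)
      \<le> 2 * (norm ?m)\<^sup>2 * (LINT x|lborel. (\<phi> x)\<^sup>2) + 2 * (LINT x|lborel. (norm (remainder k x))\<^sup>2)" .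
qed

lemma nonlocal_grad_representative:
  assumes "\<And>z. enn2real (\<rho> z) = R z"
  shows "nonlocal_grad R (wave_packet \<phi> e k) \<in> L2_representatives (weak_grad \<rho> (wave_packet \<phi> e k))"
  unfolding L2_representatives_def mem_Collect_eq
proof (intro conjI ballI)
  show "nonlocal_grad R (wave_packet \<phi> e k) \<in> L2"
    by (intro L2_lborelI nonlocal_grad_square_integral) measurable
  fix \<Phi> :: "'a \<Rightarrow> 'a"
  assume "\<Phi> \<in> test_functions"
  then obtain L' B where \<Phi>: "L'-lipschitz_on UNIV \<Phi>" "integrable lborel \<Phi>" "\<And>x. norm (\<Phi> x) \<le> B"
    by (rule test_function_regular) blast
  obtain L'' where "L''-lipschitz_on UNIV (wave_packet \<phi> e k)"
    using wave_packet_lipschitz by blast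
  moreover have "integrable lborel (wave_packet \<phi> e k)"
    using wave_packet_continuous wave_packet_vanish by (rule continuous_compact_support_integrable)
  ultimately show "weak_grad \<rho> (wave_packet \<phi> e k) \<Phi> = (LINT x|lebesgue. nonlocal_grad R (wave_packet \<phi> e k) x \<bullet> \<Phi> x)"
    using \<Phi> by (intro weak_grad_eq assms)
qed

lemma wave_packet_Hrho0:
  assumes "\<And>z. enn2real (\<rho> z) = R z" and "\<And>x. x \<notin> \<Omega> \<Longrightarrow> \<phi> x = 0"
  shows "wave_packet \<phi> e k \<in> Hrho0 \<rho> \<Omega>"
  using nonlocal_grad_representative[OF assms(1)] wave_packet_L2 assms(2)
  by (auto simp: Hrho0_def Hrho_def wave_packet_def)

text \<open>
  Bounds the squared \<open>L\<^sup>2\<close> norm of the gradient of the \<open>k\<close>-th packet, by \<open>(a + b)\<^sup>2 \<le> 2 a\<^sup>2 + 2 b\<^sup>2\<close> for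
  its two parts.
\<close>

definition grad_bound :: "nat \<Rightarrow> real" where
  "grad_bound k = 2 * (norm (symbol (real k *\<^sub>R e)))\<^sup>2 * (LINT x|lborel. (\<phi> x)\<^sup>2)
    + 2 * (LINT x|lborel. (norm (remainder k x))\<^sup>2)"

lemma dist_L2_norm_wave_packet_le:
  assumes "\<And>z. enn2real (\<rho> z) = R z"
  shows "dist_L2_norm (weak_grad \<rho> (wave_packet \<phi> e k)) \<le> sqrt (grad_bound k)"
proof -
  have "dist_L2_norm (weak_grad \<rho> (wave_packet \<phi> e k)) \<le> L2_norm_on UNIV (nonlocal_grad R (wave_packet \<phi> e k))"
    by (intro dist_L2_norm_le nonlocal_grad_representative assms)
  also have "\<dots> = sqrt (LINT x|lborel. (norm (nonlocal_grad R (wave_packet \<phi> e k) x))\<^sup>2)"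
    by (subst L2_norm_on_lborel) auto
  also have "\<dots> \<le> sqrt (grad_bound k)"
    using nonlocal_grad_square_integral(2)[of k] by (simp add: grad_bound_def)
  finally show ?thesis .
qed

lemma no_poincare_if_symbol_tendsto_0:
  assumes \<rho>: "\<And>z. enn2real (\<rho> z) = R z"
    and \<Omega>: "\<And>x. x \<notin> \<Omega> \<Longrightarrow> \<phi> x = 0" "\<Omega> \<in> sets borel"
    and pos: "0 < (LINT x|lborel. (\<phi> x)\<^sup>2)"
    and symbol: "(\<lambda>k. symbol (real k *\<^sub>R e)) \<longlonglongrightarrow> 0"
    and "0 < C"
  shows "\<exists>u\<in>Hrho0 \<rho> \<Omega>. C * dist_L2_norm (weak_grad \<rho> u) < L2_norm_on \<Omega> u"
proof (rule ccontr)
  assume "\<not> ?thesis"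
  then have "L2_norm_on \<Omega> (wave_packet \<phi> e k) \<le> C * dist_L2_norm (weak_grad \<rho> (wave_packet \<phi> e k))" for k
    using wave_packet_Hrho0[OF \<rho> \<Omega>(1)] by (meson not_le)
  then have le: "L2_norm_on \<Omega> (wave_packet \<phi> e k) \<le> C * sqrt (grad_bound k)" for k
    using mult_left_mono[OF dist_L2_norm_wave_packet_le[OF \<rho>], of C] \<open>0 < C\<close> by (meson less_imp_le order_trans)
  have "grad_bound \<longlonglongrightarrow> 2 * (norm (0::'a))\<^sup>2 * (LINT x|lborel. (\<phi> x)\<^sup>2) + 2 * 0"
    unfolding grad_bound_def by (intro tendsto_intros symbol remainder_square_tendsto)
  then have "(\<lambda>k. C * sqrt (grad_bound k)) \<longlonglongrightarrow> C * sqrt 0"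
    by (intro tendsto_intros) simp
  then have "sqrt ((LINT x|lborel. (\<phi> x)\<^sup>2) / 2) \<le> C * sqrt 0"
    using L2_norm_wave_packet_tendsto[OF \<Omega>] le by (intro LIMSEQ_le) auto
  then show False
    using pos by simp
qed

lemma Hrho_norm_wave_packet_bounded:
  assumes \<rho>: "\<And>z. enn2real (\<rho> z) = R z" and B: "\<And>k. norm (symbol (real k *\<^sub>R e)) \<le> B"
  shows "bounded (range (\<lambda>k. Hrho_norm \<rho> (wave_packet \<phi> e k)))"
proof -
  obtain B1 where B1: "\<And>k. \<bar>L2_norm_on UNIV (wave_packet \<phi> e k)\<bar> \<le> B1"
    using convergent_imp_Bseq[OF convergentI[OF L2_norm_wave_packet_tendsto[of UNIV]]] by (auto simp: Bseq_def)
  obtain B2 where B2: "\<And>k. (LINT x|lborel. (norm (remainder k x))\<^sup>2) \<le> B2"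
    using convergent_imp_Bseq[OF convergentI[OF remainder_square_tendsto]] unfolding Bseq_def
    by (metis abs_ge_self order_trans real_norm_def)
  define D where "D = 2 * B\<^sup>2 * (LINT x|lborel. (\<phi> x)\<^sup>2) + 2 * B2"
  have "norm (Hrho_norm \<rho> (wave_packet \<phi> e k)) \<le> sqrt (B1\<^sup>2 + D)" for k
  proof -
    have "(norm (symbol (real k *\<^sub>R e)))\<^sup>2 \<le> B\<^sup>2"
      by (intro power_mono B) auto
    then have "grad_bound k \<le> D"
      unfolding grad_bound_def D_def using B2[of k]
      by (intro add_mono mult_right_mono mult_left_mono) auto
    have rep: "0 \<le> dist_L2_norm (weak_grad \<rho> (wave_packet \<phi> e k))"
      using nonlocal_grad_representative[OF \<rho>] by (intro dist_L2_norm_nonneg) blast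
    have "(dist_L2_norm (weak_grad \<rho> (wave_packet \<phi> e k)))\<^sup>2 \<le> (sqrt (grad_bound k))\<^sup>2"
      by (intro power_mono rep dist_L2_norm_wave_packet_le \<rho>)
    also have "\<dots> = grad_bound k"
      unfolding grad_bound_def by (intro real_sqrt_pow2 add_nonneg_nonneg mult_nonneg_nonneg integral_nonneg) auto
    finally have "(dist_L2_norm (weak_grad \<rho> (wave_packet \<phi> e k)))\<^sup>2 \<le> D"
      using \<open>grad_bound k \<le> D\<close> by linarith
    moreover have "(L2_norm_on UNIV (wave_packet \<phi> e k))\<^sup>2 \<le> B1\<^sup>2"
      using power_mono[OF B1[of k], of 2] by simp
    ultimately show ?thesis
      by (simp add: Hrho_norm_def)
  qed
  then show ?thesis
    by (intro boundedI[where B = "sqrt (B1\<^sup>2 + D)"]) blast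
qed

end

section \<open>Necessary growth of the kernel\<close>

text \<open>
  The passage from extended to real values loses nothing: a point where \<open>q\<close> is infinite would make
  the product infinite, contrary to the strict bound.
\<close>

lemma Limsup_at_right_lessD:
  fixes q :: "real \<Rightarrow> ennreal"
  assumes "Limsup (at_right 0) (\<lambda>t. ennreal (t ^ m) * q t) < ennreal M"
  shows "\<exists>\<delta>>0. \<forall>t\<in>{0<..<\<delta>}. t ^ m * enn2real (q t) \<le> M"
proof -
  have "\<forall>\<^sub>F t in at_right 0. ennreal (t ^ m) * q t < ennreal M"
    by (rule Limsup_lessD) (rule assms)
  then obtain \<delta> where \<delta>: "0 < \<delta>" "\<And>t. 0 < t \<Longrightarrow> t < \<delta> \<Longrightarrow> ennreal (t ^ m) * q t < ennreal M"
    by (auto simp: eventually_at_right_field)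
  have "t ^ m * enn2real (q t) \<le> M" if t: "0 < t" "t < \<delta>" for t
  proof -
    have less: "ennreal (t ^ m) * q t < ennreal M"
      by (rule \<delta>(2)[OF t])
    then have "0 < ennreal M"
      by (rule le_less_trans[OF zero_le])
    have "enn2real (ennreal (t ^ m) * q t) \<le> M"
      using less \<open>0 < ennreal M\<close> by (intro enn2real_leI) auto
    then show ?thesis
      using t by (simp add: enn2real_mult)
  qed
  then show ?thesis
    using \<delta>(1) by (intro exI[of _ \<delta>]) auto
qed

text \<open>
  Differentiability away from the origin supplies the continuity on which measurability and the
  Riemann-Lebesgue lemma rest; local integrability becomes global because the support is bounded.
\<close>

lemma compact_kernel_radial:
  fixes \<rho> :: "'a::euclidean_space \<Rightarrow> ennreal"
  assumes supp: "compact (support \<rho>)"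
    and diff: "\<And>x. x \<noteq> 0 \<Longrightarrow> (\<lambda>z. enn2real (\<rho> z)) differentiable (at x)"
    and radial: "\<And>x. \<rho> x = q (norm x)"
    and loc: "L1_loc \<rho>"
  obtains S where "compact_kernel (\<lambda>z. enn2real (\<rho> z)) S"
proof -
  let ?R = "\<lambda>z. enn2real (\<rho> z)"
  have cont: "isCont ?R z" if "z \<noteq> 0" for z
    using diff[OF that] by (rule differentiable_imp_continuous_within)
  have meas [measurable]: "?R \<in> borel_measurable borel"
    using cont by (intro borel_measurable_continuous_countable_exceptions[of "{0}"])
      (auto intro!: continuous_at_imp_continuous_on)
  obtain S where S: "\<And>z. z \<in> support \<rho> \<Longrightarrow> norm z \<le> S"
    using compact_imp_bounded[OF supp] bounded_iff by metis
  have vanish: "\<rho> z = 0" if "S < norm z" for z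
    using S[of z] that closure_subset[of "{x. \<rho> x \<noteq> 0}"] unfolding support_def by (auto simp: not_le)
  have "(\<integral>\<^sup>+z. ennreal (norm (?R z)) \<partial>lborel) = (\<integral>\<^sup>+z. ennreal (norm (?R z)) \<partial>lebesgue)"
    by (simp add: nn_integral_completion)
  also have "\<dots> \<le> (\<integral>\<^sup>+z\<in>cball 0 S. \<rho> z \<partial>lebesgue)"
  proof (rule nn_integral_mono)
    fix z
    have "ennreal (?R z) \<le> \<rho> z"
      by (cases "\<rho> z") auto
    then show "ennreal (norm (?R z)) \<le> \<rho> z * indicator (cball 0 S) z"
      using vanish[of z] by (cases "S < norm z") auto
  qed
  also have "\<dots> < \<infinity>"
    using loc by (auto simp: L1_loc_def)
  finally have "integrable lborel ?R"
    by (intro integrableI_bounded) auto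
  then have "compact_kernel ?R S"
    using cont vanish by unfold_locales (auto simp: radial)
  then show thesis
    by (rule that)
qed

theorem proposition7p5:
  fixes \<Omega> :: "(real ^ 'n) set"
    and \<rho> :: "real ^ 'n \<Rightarrow> ennreal"
    and \<rho>bar :: "real \<Rightarrow> ennreal"
    and f\<^sub>\<rho> :: "real \<Rightarrow> real"
    and \<epsilon> \<mu> \<gamma> :: real
  assumes "\<Omega> \<noteq> {}" and "open \<Omega>" and "bounded \<Omega>"
    and "compact (support \<rho>)"
    and "\<And>x. x \<noteq> 0 \<Longrightarrow> (\<lambda>z. enn2real (\<rho> z)) differentiable (at x)"
    and "\<epsilon> > 0"
    and radial: "\<And>x. \<rho> x = \<rho>bar (norm x)"
    and "\<And>x. x \<noteq> 0 \<Longrightarrow> \<rho> x < \<infinity>"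
    and "L1_loc \<rho>"
    and "(\<integral>\<^sup>+x. ennreal (min 1 (inverse (norm x))) * \<rho> x \<partial>lebesgue) < \<infinity>"
    and "(INF x\<in>ball 0 \<epsilon>. \<rho> x) > 0"
    and f_def: "\<And>t. t > 0 \<Longrightarrow> f\<^sub>\<rho> t = t powi (int CARD('n) - 2) * enn2real (\<rho>bar t)"
    and "antimono_on {0<..} f\<^sub>\<rho>"
    and "0 < \<mu>" and "\<mu> < 1"
    and "\<And>t. t \<in> {0<..<\<epsilon>} \<Longrightarrow> \<mu> * f\<^sub>\<rho> (t / 2) \<ge> f\<^sub>\<rho> t"
    and "\<gamma> \<in> {0<..<1}"
    and "almost_increasing_on {0<..<\<epsilon>}
           (\<lambda>t. t powr (real CARD('n) + \<gamma> - 1) * enn2real (\<rho>bar t))"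
  shows "((\<exists>C>0. \<forall>u\<in>Hrho0 \<rho> \<Omega>.
             L2_norm_on \<Omega> u \<le> C * dist_L2_norm (weak_grad \<rho> u))
           \<longrightarrow> Limsup (at_right 0) (\<lambda>t. ennreal (t ^ (CARD('n) - 1)) * \<rho>bar t) > 0)
       \<and> (compactly_embedded_L2 (Hrho0 \<rho> \<Omega>) (Hrho_norm \<rho>)
           \<longrightarrow> Limsup (at_right 0) (\<lambda>t. ennreal (t ^ (CARD('n) - 1)) * \<rho>bar t) = \<infinity>)"
proof -
  define R where "R z = enn2real (\<rho> z)" for z
  obtain S where S: "compact_kernel R S"
    unfolding R_def using compact_kernel_radial[OF assms(4,5) radial \<open>L1_loc \<rho>\<close>] by blast
  obtain e :: "real ^ 'n" where e: "norm e = 1"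
    using norm_axis_1 by blast
  obtain \<phi> r where env: "envelope \<phi> e 1 r"
    and \<phi>: "\<And>x. x \<notin> \<Omega> \<Longrightarrow> \<phi> x = 0" "0 < (LINT x|lborel. (\<phi> x)\<^sup>2)"
    using cone_envelope[OF \<open>\<Omega> \<noteq> {}\<close> \<open>open \<Omega>\<close> e] by blast
  interpret compact_kernel R S
    by (rule S)
  interpret envelope \<phi> e 1 r
    by (rule env)
  interpret wave_packet_gradient R S \<phi> e 1 r ..
  have \<Omega>: "\<Omega> \<in> sets borel"
    using \<open>open \<Omega>\<close> by simp
  have \<rho>: "enn2real (\<rho> z) = R z" for z
    by (simp add: R_def)
  have f_eq: "f\<^sub>\<rho> t = t ^ CARD('n) / t\<^sup>2 * enn2real (\<rho>bar t)" if "0 < t" for t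
    using that f_def[OF that] by (simp add: power_int_diff)
  have R_eq: "R z = f\<^sub>\<rho> (norm z) * (norm z)\<^sup>2 / norm z ^ DIM(real ^ 'n)" if "z \<noteq> 0" for z
    using that f_eq[of "norm z"] by (simp add: R_def radial)
  \<comment> \<open>The quantity in the upper limit is exactly the one that controls the sine transforms.\<close>
  have tf: "t * f\<^sub>\<rho> t = t ^ (CARD('n) - 1) * enn2real (\<rho>bar t)" if "0 < t" for t
  proof -
    have "t ^ CARD('n) = t ^ (CARD('n) - 1) * t"
      using power_minus_mult[of "CARD('n)" t] by simp
    then show ?thesis
      using that by (simp add: f_eq power2_eq_square)
  qed
  let ?limsup = "Limsup (at_right 0) (\<lambda>t. ennreal (t ^ (CARD('n) - 1)) * \<rho>bar t)"
  have bound: "\<exists>\<delta>>0. \<forall>t\<in>{0<..<\<delta>}. t * f\<^sub>\<rho> t \<le> M" if "?limsup < ennreal M" for M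
    using Limsup_at_right_lessD[OF that] by (auto simp: tf)
  show ?thesis
  proof (intro conjI impI)
    assume "\<exists>C>0. \<forall>u\<in>Hrho0 \<rho> \<Omega>. L2_norm_on \<Omega> u \<le> C * dist_L2_norm (weak_grad \<rho> u)"
    then obtain C where C: "0 < C" "\<And>u. u \<in> Hrho0 \<rho> \<Omega> \<Longrightarrow> L2_norm_on \<Omega> u \<le> C * dist_L2_norm (weak_grad \<rho> u)"
      by blast
    show "0 < ?limsup"
    proof (rule ccontr)
      assume "\<not> 0 < ?limsup"
      then have zero: "?limsup = 0"
        by (simp only: not_gr_zero)
      have "(\<lambda>k. symbol (real k *\<^sub>R e)) \<longlonglongrightarrow> 0"
      proof (rule symbol_tendsto_0[OF e \<open>antimono_on {0<..} f\<^sub>\<rho>\<close> R_eq])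
        show "\<exists>\<delta>>0. \<forall>t\<in>{0<..<\<delta>}. t * f\<^sub>\<rho> t \<le> M" if "0 < M" for M
          using that by (intro bound) (simp only: zero ennreal_less_zero_iff)
      qed
      then show False
        using no_poincare_if_symbol_tendsto_0[OF \<rho> \<phi>(1) \<Omega> \<phi>(2) _ C(1)] C(2) by (meson not_le)
    qed
  next
    assume emb: "compactly_embedded_L2 (Hrho0 \<rho> \<Omega>) (Hrho_norm \<rho>)"
    show "?limsup = \<infinity>"
    proof (rule ccontr)
      assume "?limsup \<noteq> \<infinity>"
      then obtain l where l: "?limsup = ennreal l" "0 \<le> l"
        by (cases ?limsup) auto
      then have "?limsup < ennreal (l + 1)"
        by (simp add: ennreal_less_iff)
      then obtain \<delta> where "0 < \<delta>" "\<And>t. 0 < t \<Longrightarrow> t < \<delta> \<Longrightarrow> t * f\<^sub>\<rho> t \<le> l + 1"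
        using bound by (metis greaterThanLessThan_iff)
      then obtain B where "\<And>k. norm (symbol (real k *\<^sub>R e)) \<le> B"
        using symbol_bounded[OF e \<open>antimono_on {0<..} f\<^sub>\<rho>\<close> R_eq] by blast
      then have "bounded (range (\<lambda>k. Hrho_norm \<rho> (wave_packet \<phi> e k)))"
        by (rule Hrho_norm_wave_packet_bounded[OF \<rho>])
      moreover have "range (wave_packet \<phi> e) \<subseteq> Hrho0 \<rho> \<Omega>"
        using wave_packet_Hrho0[OF \<rho> \<phi>(1)] by blast
      ultimately obtain n v where "strict_mono n" "v \<in> L2"
        "(\<lambda>k. L2_norm_on UNIV (\<lambda>x. wave_packet \<phi> e (n k) x - v x)) \<longlonglongrightarrow> 0"
        using emb unfolding compactly_embedded_L2_def by blast
      then show False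
        using wave_packet_no_convergent_subseq[OF \<phi>(2)] by blast
    qed
  qed
qed

end
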